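(* (Provable in the theory $\mathsf{C}$.) Let $\rho$ be a signature and let $\mathfrak S$ be a $\rho$-structure (which may be a proper class). Then there is a unique $\mathcal T^\rho$-valuation function for $\mathfrak S$, where $\mathcal T^\rho$ is the class of all $\rho$-terms.
   Context: $\mathsf{S}$ denotes Zermelo–Fraenkel set theory $\mathsf{ZF}$ with the Axiom of Infinity omitted (not replaced by its negation); $\mathsf{C}$ denotes Gödel–Bernays class theory $\mathsf{GB}$ with the Axiom of Infinity omitted. $\mathsf{C}$ has two sorts, sets and classes; every set is a class; a class is proper if it is not a set; class comprehension is only for formulas without bound class variables. Structures $(D_0,D_1,\dots;X_0,X_1,\dots)$ with domains $D_i$ and predicates/operations $X_j$ may be proper classes; $|\mathfrak S|$ denotes the universe of $\mathfrak S$. Expressions of a language are coded as (hereditarily finite, when the signature is) sets, with expression-building operations rank-increasing. For an expression $\epsilon$, $\mathrm{Free}\,\epsilon$ is its set of free variables; an $\mathfrak S$-assignment for $\epsilon$ is a finite function into $|\mathfrak S|$ whose domain includes $\mathrm{Free}\,\epsilon$. For a class $\Phi$ of $\rho$-expressions, let $\mathrm{Sub}(\Phi)$ be the class of subexpressions of members of $\Phi$ (each expression is a subexpression of itself). A $\Phi$-valuation function for $\mathfrak S$ is a function $F$ whose domain is the class of all pairs $\langle\epsilon,A\rangle$ with $\epsilon\in\mathrm{Sub}(\Phi)$ and $A$ an $\mathfrak S$-assignment for $\epsilon$, with $F\langle\epsilon,A\rangle\in|\mathfrak S|$ if $\epsilon$ is a term and $\in\{0,1\}$ if $\epsilon$ is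 a formula, satisfying the usual (Tarskian) recursive clauses for valuation. *)

theory Defs
  imports Main
begin

text \<open>
  \<open>predicative_fm\<close> is the syntax of the formulas of class theory without bound class variables.
  Variables are de Bruijn indices; a free index may denote any class (so class parameters are
  allowed), but \<open>AllSet\<close> binds a variable ranging over sets only.
\<close>

datatype predicative_fm =
    Mem nat nat
  | Eq nat nat
  | Neg predicative_fm
  | Conj predicative_fm predicative_fm
  | AllSet predicative_fm

text \<open>
  Everything below is relative to a structure for the language of class theory: a type of classes
  with a membership relation. All object-level notions (natural number, finite, sequence, term,
  formula, ...) are the internal ones: they are given by conditions on \<open>mem\<close> that only quantify
  over sets, never by HOL's own numbers, lists or inductive definitions. HOL's natural
  numbers occur only in the schema of comprehension and in the finitely many numerals that serve
  as tags.
\<close>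

locale class_language =
  fixes mem :: "'c \<Rightarrow> 'c \<Rightarrow> bool"  (infix "\<epsilon>" 50)
begin

definition isset :: "'c \<Rightarrow> bool" where
  "isset x \<longleftrightarrow> (\<exists>Y. x \<epsilon> Y)"

abbreviation all_sets :: "('c \<Rightarrow> bool) \<Rightarrow> bool"  (binder "\<forall>\<^sub>S" 10) where
  "all_sets P \<equiv> \<forall>x. isset x \<longrightarrow> P x"

abbreviation ex_set :: "('c \<Rightarrow> bool) \<Rightarrow> bool"  (binder "\<exists>\<^sub>S" 10) where
  "ex_set P \<equiv> \<exists>x. isset x \<and> P x"

primrec sat :: "predicative_fm \<Rightarrow> (nat \<Rightarrow> 'c) \<Rightarrow> bool" where
  "sat (Mem i j) env \<longleftrightarrow> env i \<epsilon> env j"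
| "sat (Eq i j) env \<longleftrightarrow> env i = env j"
| "sat (Neg p) env \<longleftrightarrow> \<not> sat p env"
| "sat (Conj p q) env \<longleftrightarrow> sat p env \<and> sat q env"
| "sat (AllSet p) env \<longleftrightarrow> (\<forall>\<^sub>S x. sat p (case_nat x env))"

text \<open>
  The class of all sets with the property \<open>P\<close>. It exists whenever \<open>P\<close> is expressible without
  bound class variables, as is the case in each use below.
\<close>

definition class_of :: "('c \<Rightarrow> bool) \<Rightarrow> 'c"  (binder "CLASS " 10) where
  "class_of P = (THE X. \<forall>x. x \<epsilon> X \<longleftrightarrow> isset x \<and> P x)"

definition included :: "'c \<Rightarrow> 'c \<Rightarrow> bool"  (infix "\<sqsubseteq>" 50) where
  "X \<sqsubseteq> Y \<longleftrightarrow> (\<forall>x. x \<epsilon> X \<longrightarrow> x \<epsilon> Y)"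

definition empty :: 'c where
  "empty = (CLASS u. False)"

definition upair :: "'c \<Rightarrow> 'c \<Rightarrow> 'c" where
  "upair x y = (CLASS u. u = x \<or> u = y)"

definition opair :: "'c \<Rightarrow> 'c \<Rightarrow> 'c"  ("(\<langle>_,/ _\<rangle>)") where
  "\<langle>x, y\<rangle> = upair (upair x x) (upair x y)"

definition is_function :: "'c \<Rightarrow> bool" where
  "is_function F \<longleftrightarrow>
     (\<forall>p. p \<epsilon> F \<longrightarrow> (\<exists>\<^sub>S x y. p = \<langle>x, y\<rangle>)) \<and>
     (\<forall>\<^sub>S x y z. \<langle>x, y\<rangle> \<epsilon> F \<and> \<langle>x, z\<rangle> \<epsilon> F \<longrightarrow> y = z)"

definition dom :: "'c \<Rightarrow> 'c" where
  "dom F = (CLASS x. \<exists>\<^sub>S y. \<langle>x, y\<rangle> \<epsilon> F)"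

definition app :: "'c \<Rightarrow> 'c \<Rightarrow> 'c"  (infixl "\<bullet>" 80) where
  "F \<bullet> x = (THE y. isset y \<and> \<langle>x, y\<rangle> \<epsilon> F)"

end

text \<open>
  Models of Goedel-Bernays class theory with the Axiom of Infinity omitted (neither it nor its
  negation is assumed, and neither is Choice). A set is a class that is a member of some class.
  The axiom \<open>set_exists\<close> says that the sort of sets is nonempty, which is otherwise a consequence
  of Infinity. Foundation is assumed for sets only, which is the weakest of the usual forms.
\<close>

locale class_theory_C = class_language +
  assumes extensionality: "(\<forall>z. z \<epsilon> X \<longleftrightarrow> z \<epsilon> Y) \<Longrightarrow> X = Y"
    and set_exists: "\<exists>x. isset x"
    and comprehension: "\<exists>X. \<forall>\<^sub>S x. x \<epsilon> X \<longleftrightarrow> sat p (case_nat x env)"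
    and pairing: "isset x \<Longrightarrow> isset y \<Longrightarrow> \<exists>\<^sub>S z. \<forall>u. u \<epsilon> z \<longleftrightarrow> u = x \<or> u = y"
    and union: "isset x \<Longrightarrow> \<exists>\<^sub>S z. \<forall>u. u \<epsilon> z \<longleftrightarrow> (\<exists>y. y \<epsilon> x \<and> u \<epsilon> y)"
    and powerset: "isset x \<Longrightarrow> \<exists>\<^sub>S z. \<forall>u. u \<epsilon> z \<longleftrightarrow> isset u \<and> u \<sqsubseteq> x"
    and replacement: "is_function F \<Longrightarrow> isset a \<Longrightarrow>
          \<exists>\<^sub>S b. \<forall>\<^sub>S y. y \<epsilon> b \<longleftrightarrow> (\<exists>x. x \<epsilon> a \<and> \<langle>x, y\<rangle> \<epsilon> F)"
    and foundation: "isset a \<Longrightarrow> \<exists>x. x \<epsilon> a \<Longrightarrow>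
          \<exists>x. x \<epsilon> a \<and> \<not> (\<exists>y. y \<epsilon> x \<and> y \<epsilon> a)"

context class_language
begin

definition succ :: "'c \<Rightarrow> 'c" where
  "succ n = (CLASS u. u \<epsilon> n \<or> u = n)"

primrec num :: "nat \<Rightarrow> 'c" where
  "num 0 = empty"
| "num (Suc k) = succ (num k)"

definition transitive :: "'c \<Rightarrow> bool" where
  "transitive x \<longleftrightarrow> (\<forall>y. y \<epsilon> x \<longrightarrow> y \<sqsubseteq> x)"

text \<open>A natural number is an ordinal \<open>n\<close> such that no ordinal \<open>\<le> n\<close> is a limit.\<close>

definition is_nat :: "'c \<Rightarrow> bool" where
  "is_nat n \<longleftrightarrow> isset n \<and> transitive n \<and> (\<forall>x. x \<epsilon> n \<longrightarrow> transitive x) \<and>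
     (\<forall>x. x \<epsilon> n \<or> x = n \<longrightarrow> x = empty \<or> (\<exists>\<^sub>S y. x = succ y))"

definition is_seq :: "'c \<Rightarrow> 'c \<Rightarrow> bool" where
  "is_seq n s \<longleftrightarrow> isset s \<and> is_function s \<and> dom s = n"

definition is_finite :: "'c \<Rightarrow> bool" where
  "is_finite a \<longleftrightarrow> isset a \<and>
     (\<exists>\<^sub>S n f. is_nat n \<and> is_seq n f \<and>
        (\<forall>i j. i \<epsilon> n \<and> j \<epsilon> n \<and> f \<bullet> i = f \<bullet> j \<longrightarrow> i = j) \<and>
        (\<forall>x. x \<epsilon> a \<longleftrightarrow> (\<exists>i. i \<epsilon> n \<and> x = f \<bullet> i)))"

text \<open>
  A signature maps each of its symbols to a pair consisting of a kind (0: domain, 1: predicate,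
  2: operation) and an arity. Constants are operation symbols of arity 0. Domain symbols behave
  as unary predicates. A signature may have several domain symbols and may be a proper class.
\<close>

definition is_signature :: "'c \<Rightarrow> bool" where
  "is_signature \<rho> \<longleftrightarrow> is_function \<rho> \<and>
     (\<forall>\<^sub>S X k. \<langle>X, k\<rangle> \<epsilon> \<rho> \<longrightarrow>
        k = \<langle>num 0, num 1\<rangle> \<or> (\<exists>\<^sub>S n. is_nat n \<and> (k = \<langle>num 1, n\<rangle> \<or> k = \<langle>num 2, n\<rangle>)))"

definition dom_symbol :: "'c \<Rightarrow> 'c \<Rightarrow> bool" where
  "dom_symbol \<rho> d \<longleftrightarrow> isset d \<and> \<langle>d, \<langle>num 0, num 1\<rangle>\<rangle> \<epsilon> \<rho>"

definition pred_symbol :: "'c \<Rightarrow> 'c \<Rightarrow> 'c \<Rightarrow> bool" where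
  "pred_symbol \<rho> P n \<longleftrightarrow> isset P \<and> isset n \<and> \<langle>P, \<langle>num 1, n\<rangle>\<rangle> \<epsilon> \<rho>"

definition op_symbol :: "'c \<Rightarrow> 'c \<Rightarrow> 'c \<Rightarrow> bool" where
  "op_symbol \<rho> f n \<longleftrightarrow> isset f \<and> isset n \<and> \<langle>f, \<langle>num 2, n\<rangle>\<rangle> \<epsilon> \<rho>"

text \<open>
  A structure has possibly proper classes as its components, so it is coded as the single class
  of all pairs \<open>\<langle>X, u\<rangle>\<close> with \<open>X\<close> a symbol and \<open>u\<close> a member of the component named by \<open>X\<close>.
  The universe is the union of the domains; it is not required to be nonempty.
\<close>

definition interp :: "'c \<Rightarrow> 'c \<Rightarrow> 'c" where
  "interp \<SS> X = (CLASS u. \<langle>X, u\<rangle> \<epsilon> \<SS>)"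

definition universe :: "'c \<Rightarrow> 'c \<Rightarrow> 'c" where
  "universe \<rho> \<SS> = (CLASS u. \<exists>d. dom_symbol \<rho> d \<and> u \<epsilon> interp \<SS> d)"

definition tuple_in :: "'c \<Rightarrow> 'c \<Rightarrow> 'c \<Rightarrow> bool" where
  "tuple_in D n s \<longleftrightarrow> is_seq n s \<and> (\<forall>i. i \<epsilon> n \<longrightarrow> s \<bullet> i \<epsilon> D)"

definition is_structure :: "'c \<Rightarrow> 'c \<Rightarrow> bool" where
  "is_structure \<rho> \<SS> \<longleftrightarrow>
     (\<forall>p. p \<epsilon> \<SS> \<longrightarrow> (\<exists>\<^sub>S X u. X \<epsilon> dom \<rho> \<and> p = \<langle>X, u\<rangle>)) \<and>
     (\<forall>P n. pred_symbol \<rho> P n \<longrightarrow>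
        (\<forall>s. s \<epsilon> interp \<SS> P \<longrightarrow> tuple_in (universe \<rho> \<SS>) n s)) \<and>
     (\<forall>f n. op_symbol \<rho> f n \<longrightarrow>
        is_function (interp \<SS> f) \<and>
        (\<forall>s. s \<epsilon> dom (interp \<SS> f) \<longleftrightarrow> tuple_in (universe \<rho> \<SS>) n s) \<and>
        (\<forall>s. s \<epsilon> dom (interp \<SS> f) \<longrightarrow> interp \<SS> f \<bullet> s \<epsilon> universe \<rho> \<SS>))"

definition VarE :: "'c \<Rightarrow> 'c" where "VarE n = \<langle>num 0, n\<rangle>"
definition OpE :: "'c \<Rightarrow> 'c \<Rightarrow> 'c" where "OpE f s = \<langle>num 1, \<langle>f, s\<rangle>\<rangle>"
definition DomE :: "'c \<Rightarrow> 'c \<Rightarrow> 'c" where "DomE d t = \<langle>num 2, \<langle>d, t\<rangle>\<rangle>"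
definition PredE :: "'c \<Rightarrow> 'c \<Rightarrow> 'c" where "PredE P s = \<langle>num 3, \<langle>P, s\<rangle>\<rangle>"
definition EqE :: "'c \<Rightarrow> 'c \<Rightarrow> 'c" where "EqE t u = \<langle>num 4, \<langle>t, u\<rangle>\<rangle>"
definition NegE :: "'c \<Rightarrow> 'c" where "NegE a = \<langle>num 5, a\<rangle>"
definition AndE :: "'c \<Rightarrow> 'c \<Rightarrow> 'c" where "AndE a b = \<langle>num 6, \<langle>a, b\<rangle>\<rangle>"
definition OrE :: "'c \<Rightarrow> 'c \<Rightarrow> 'c" where "OrE a b = \<langle>num 7, \<langle>a, b\<rangle>\<rangle>"
definition ImpE :: "'c \<Rightarrow> 'c \<Rightarrow> 'c" where "ImpE a b = \<langle>num 8, \<langle>a, b\<rangle>\<rangle>"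
definition IffE :: "'c \<Rightarrow> 'c \<Rightarrow> 'c" where "IffE a b = \<langle>num 9, \<langle>a, b\<rangle>\<rangle>"
definition AllE :: "'c \<Rightarrow> 'c \<Rightarrow> 'c" where "AllE x a = \<langle>num 10, \<langle>x, a\<rangle>\<rangle>"
definition ExE :: "'c \<Rightarrow> 'c \<Rightarrow> 'c" where "ExE x a = \<langle>num 11, \<langle>x, a\<rangle>\<rangle>"

definition is_var :: "'c \<Rightarrow> bool" where
  "is_var x \<longleftrightarrow> (\<exists>n. is_nat n \<and> x = VarE n)"

text \<open>
  \<open>formed step e\<close>: there is a finite formation sequence ending in \<open>e\<close>, each entry of which is
  obtained by \<open>step\<close> from earlier entries.
\<close>

definition formed :: "(('c \<Rightarrow> bool) \<Rightarrow> 'c \<Rightarrow> bool) \<Rightarrow> 'c \<Rightarrow> bool" where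
  "formed step e \<longleftrightarrow> (\<exists>\<^sub>S n s. is_nat n \<and> is_seq (succ n) s \<and> s \<bullet> n = e \<and>
     (\<forall>i. i \<epsilon> succ n \<longrightarrow> step (\<lambda>d. \<exists>j. j \<epsilon> i \<and> d = s \<bullet> j) (s \<bullet> i)))"

definition term_step :: "'c \<Rightarrow> ('c \<Rightarrow> bool) \<Rightarrow> 'c \<Rightarrow> bool" where
  "term_step \<rho> Prev e \<longleftrightarrow> is_var e \<or>
     (\<exists>f n s. op_symbol \<rho> f n \<and> is_seq n s \<and> (\<forall>i. i \<epsilon> n \<longrightarrow> Prev (s \<bullet> i)) \<and> e = OpE f s)"

definition is_term :: "'c \<Rightarrow> 'c \<Rightarrow> bool" where
  "is_term \<rho> = formed (term_step \<rho>)"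

definition formula_step :: "'c \<Rightarrow> ('c \<Rightarrow> bool) \<Rightarrow> 'c \<Rightarrow> bool" where
  "formula_step \<rho> Prev e \<longleftrightarrow>
     (\<exists>d t. dom_symbol \<rho> d \<and> is_term \<rho> t \<and> e = DomE d t) \<or>
     (\<exists>P n s. pred_symbol \<rho> P n \<and> is_seq n s \<and> (\<forall>i. i \<epsilon> n \<longrightarrow> is_term \<rho> (s \<bullet> i)) \<and> e = PredE P s) \<or>
     (\<exists>t u. is_term \<rho> t \<and> is_term \<rho> u \<and> e = EqE t u) \<or>
     (\<exists>a. Prev a \<and> e = NegE a) \<or>
     (\<exists>a b. Prev a \<and> Prev b \<and> (e = AndE a b \<or> e = OrE a b \<or> e = ImpE a b \<or> e = IffE a b)) \<or>
     (\<exists>x a. is_var x \<and> Prev a \<and> (e = AllE x a \<or> e = ExE x a))"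

definition is_formula :: "'c \<Rightarrow> 'c \<Rightarrow> bool" where
  "is_formula \<rho> = formed (formula_step \<rho>)"

definition Terms :: "'c \<Rightarrow> 'c" where
  "Terms \<rho> = (CLASS t. is_term \<rho> t)"

definition immediate_sub :: "'c \<Rightarrow> 'c \<Rightarrow> bool" where
  "immediate_sub d e \<longleftrightarrow>
     (\<exists>\<^sub>S X s. (e = OpE X s \<or> e = PredE X s) \<and> (\<exists>i. i \<epsilon> dom s \<and> d = s \<bullet> i)) \<or>
     (\<exists>\<^sub>S X. e = DomE X d) \<or>
     (\<exists>\<^sub>S t u. e = EqE t u \<and> (d = t \<or> d = u)) \<or>
     e = NegE d \<or>
     (\<exists>\<^sub>S a b. (e = AndE a b \<or> e = OrE a b \<or> e = ImpE a b \<or> e = IffE a b) \<and> (d = a \<or> d = b)) \<or>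
     (\<exists>\<^sub>S x. e = AllE x d \<or> e = ExE x d)"

definition is_path :: "'c \<Rightarrow> 'c \<Rightarrow> 'c \<Rightarrow> 'c \<Rightarrow> bool" where
  "is_path n s e d \<longleftrightarrow> is_nat n \<and> is_seq (succ n) s \<and> s \<bullet> empty = e \<and> s \<bullet> n = d \<and>
     (\<forall>i. i \<epsilon> n \<longrightarrow> immediate_sub (s \<bullet> succ i) (s \<bullet> i))"

definition subexpression :: "'c \<Rightarrow> 'c \<Rightarrow> bool" where
  "subexpression d e \<longleftrightarrow> (\<exists>\<^sub>S n s. is_path n s e d)"

definition Sub :: "'c \<Rightarrow> 'c" where
  "Sub \<Phi> = (CLASS d. \<exists>e. e \<epsilon> \<Phi> \<and> subexpression d e)"

text \<open>
  A variable is free in \<open>e\<close> if it has an occurrence in \<open>e\<close> (a path of successive immediate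
  subexpressions from \<open>e\<close> down to it) outside the scope of every quantifier binding it.
\<close>

definition Free :: "'c \<Rightarrow> 'c" where
  "Free e = (CLASS x. is_var x \<and> (\<exists>\<^sub>S n s. is_path n s e x \<and>
     (\<forall>i. i \<epsilon> succ n \<longrightarrow> \<not> (\<exists>\<^sub>S a. s \<bullet> i = AllE x a \<or> s \<bullet> i = ExE x a))))"

definition is_assignment :: "'c \<Rightarrow> 'c \<Rightarrow> 'c \<Rightarrow> 'c \<Rightarrow> bool" where
  "is_assignment \<rho> \<SS> e A \<longleftrightarrow> is_finite A \<and> is_function A \<and>
     (\<forall>x. x \<epsilon> dom A \<longrightarrow> A \<bullet> x \<epsilon> universe \<rho> \<SS>) \<and> Free e \<sqsubseteq> dom A"

definition update :: "'c \<Rightarrow> 'c \<Rightarrow> 'c \<Rightarrow> 'c" where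
  "update A x a = (CLASS p. p = \<langle>x, a\<rangle> \<or> (p \<epsilon> A \<and> \<not> (\<exists>\<^sub>S b. p = \<langle>x, b\<rangle>)))"

definition values_of :: "'c \<Rightarrow> 'c \<Rightarrow> 'c \<Rightarrow> 'c \<Rightarrow> bool" where
  "values_of F A s v \<longleftrightarrow> is_seq (dom s) v \<and> (\<forall>i. i \<epsilon> dom s \<longrightarrow> v \<bullet> i = F \<bullet> \<langle>s \<bullet> i, A\<rangle>)"

definition tarski_clauses :: "'c \<Rightarrow> 'c \<Rightarrow> 'c \<Rightarrow> 'c \<Rightarrow> 'c \<Rightarrow> bool" where
  "tarski_clauses \<rho> \<SS> F e A \<longleftrightarrow>
     (is_var e \<longrightarrow> F \<bullet> \<langle>e, A\<rangle> = A \<bullet> e) \<and>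
     (\<forall>\<^sub>S f s. e = OpE f s \<longrightarrow>
        (\<exists>v. values_of F A s v \<and> F \<bullet> \<langle>e, A\<rangle> = interp \<SS> f \<bullet> v)) \<and>
     (\<forall>\<^sub>S d t. e = DomE d t \<longrightarrow>
        (F \<bullet> \<langle>e, A\<rangle> = num 1 \<longleftrightarrow> F \<bullet> \<langle>t, A\<rangle> \<epsilon> interp \<SS> d)) \<and>
     (\<forall>\<^sub>S P s. e = PredE P s \<longrightarrow>
        (F \<bullet> \<langle>e, A\<rangle> = num 1 \<longleftrightarrow> (\<exists>v. values_of F A s v \<and> v \<epsilon> interp \<SS> P))) \<and>
     (\<forall>\<^sub>S t u. e = EqE t u \<longrightarrow>
        (F \<bullet> \<langle>e, A\<rangle> = num 1 \<longleftrightarrow> F \<bullet> \<langle>t, A\<rangle> = F \<bullet> \<langle>u, A\<rangle>)) \<and>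
     (\<forall>\<^sub>S a. e = NegE a \<longrightarrow>
        (F \<bullet> \<langle>e, A\<rangle> = num 1 \<longleftrightarrow> F \<bullet> \<langle>a, A\<rangle> \<noteq> num 1)) \<and>
     (\<forall>\<^sub>S a b. e = AndE a b \<longrightarrow>
        (F \<bullet> \<langle>e, A\<rangle> = num 1 \<longleftrightarrow> F \<bullet> \<langle>a, A\<rangle> = num 1 \<and> F \<bullet> \<langle>b, A\<rangle> = num 1)) \<and>
     (\<forall>\<^sub>S a b. e = OrE a b \<longrightarrow>
        (F \<bullet> \<langle>e, A\<rangle> = num 1 \<longleftrightarrow> F \<bullet> \<langle>a, A\<rangle> = num 1 \<or> F \<bullet> \<langle>b, A\<rangle> = num 1)) \<and>
     (\<forall>\<^sub>S a b. e = ImpE a b \<longrightarrow>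
        (F \<bullet> \<langle>e, A\<rangle> = num 1 \<longleftrightarrow> (F \<bullet> \<langle>a, A\<rangle> = num 1 \<longrightarrow> F \<bullet> \<langle>b, A\<rangle> = num 1))) \<and>
     (\<forall>\<^sub>S a b. e = IffE a b \<longrightarrow>
        (F \<bullet> \<langle>e, A\<rangle> = num 1 \<longleftrightarrow> (F \<bullet> \<langle>a, A\<rangle> = num 1 \<longleftrightarrow> F \<bullet> \<langle>b, A\<rangle> = num 1))) \<and>
     (\<forall>\<^sub>S x a. e = AllE x a \<longrightarrow>
        (F \<bullet> \<langle>e, A\<rangle> = num 1 \<longleftrightarrow>
          (\<forall>c. c \<epsilon> universe \<rho> \<SS> \<longrightarrow> F \<bullet> \<langle>a, update A x c\<rangle> = num 1))) \<and>
     (\<forall>\<^sub>S x a. e = ExE x a \<longrightarrow>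
        (F \<bullet> \<langle>e, A\<rangle> = num 1 \<longleftrightarrow>
          (\<exists>c. c \<epsilon> universe \<rho> \<SS> \<and> F \<bullet> \<langle>a, update A x c\<rangle> = num 1)))"

definition is_valuation_function :: "'c \<Rightarrow> 'c \<Rightarrow> 'c \<Rightarrow> 'c \<Rightarrow> bool" where
  "is_valuation_function \<rho> \<SS> \<Phi> F \<longleftrightarrow>
     is_function F \<and>
     dom F = (CLASS p. \<exists>\<^sub>S e A. p = \<langle>e, A\<rangle> \<and> e \<epsilon> Sub \<Phi> \<and> is_assignment \<rho> \<SS> e A) \<and>
     (\<forall>e A. e \<epsilon> Sub \<Phi> \<and> is_assignment \<rho> \<SS> e A \<longrightarrow>
        (is_term \<rho> e \<longrightarrow> F \<bullet> \<langle>e, A\<rangle> \<epsilon> universe \<rho> \<SS>) \<and>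
        (is_formula \<rho> e \<longrightarrow> F \<bullet> \<langle>e, A\<rangle> = num 0 \<or> F \<bullet> \<langle>e, A\<rangle> = num 1) \<and>
        tarski_clauses \<rho> \<SS> F e A)"

end

end

theory Submission
  imports Defs
begin

text \<open>
  Fix an assignment \<open>A\<close>. A term \<open>e\<close> gets the value \<open>v\<close> if some set of pairs that is closed under
  arguments and obeys the recursive clauses contains \<open>\<langle>e, v\<rangle>\<close>. Induction along formation sequences,
  by Foundation, gives uniqueness of the value. Without Infinity and Choice, existence needs a set
  witness: a formation sequence of \<open>e\<close> has as its range a set \<open>D\<close> of terms closed under arguments,
  and by Replacement the pairs \<open>\<langle>d, v\<rangle>\<close> with \<open>d\<close> in \<open>D\<close> and \<open>v\<close> the value of \<open>d\<close>, as far as it exists,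
  form a set to which the pair of a compound term, all of whose arguments have values, can be
  adjoined. "\<open>e\<close> has the value \<open>v\<close> under \<open>A\<close>" quantifies over sets only, so comprehension yields the
  valuation function as a class.
\<close>

subsection \<open>Predicative properties and comprehension\<close>

text \<open>The obstacle is the distance between HOL and the object theory.
  \<open>comprehension\<close> covers only formulas of \<open>predicative_fm\<close>, whereas
  \<open>is_term\<close>, \<open>Free\<close> and the other notions are HOL predicates, some of
  which use \<open>app\<close>, a \<open>THE\<close> term with no specified value outside the domain
  of a function, or quantify over arbitrary classes. So properties are tracked by
  \<open>predicative\<close> and class-valued expressions by \<open>definable\<close>, and a notion
  outside this fragment first gets an equivalent inside it: \<open>val\<close> for
  \<open>app\<close>, \<open>term_formation\<close> for \<open>formed\<close>,
  \<open>subterm\<close> for \<open>subexpression\<close>. Induction hypotheses must be predicative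
  as well, since Foundation concerns sets and the counterexamples have to be separated out as a set.
  Choice threatens at a compound term: each argument has some witnessing set of pairs, and picking
  one witness per argument would be a choice. Uniqueness of values therefore has to precede
  existence.\<close>

primrec rename :: "(nat \<Rightarrow> nat) \<Rightarrow> predicative_fm \<Rightarrow> predicative_fm" where
  "rename f (Mem i j) = Mem (f i) (f j)"
| "rename f (Eq i j) = Eq (f i) (f j)"
| "rename f (Neg p) = Neg (rename f p)"
| "rename f (Conj p q) = Conj (rename f p) (rename f q)"
| "rename f (AllSet p) = AllSet (rename (case_nat 0 (\<lambda>n. Suc (f n))) p)"

named_theorems predicative_intros

context class_theory_C
begin

lemma sat_rename: "sat (rename f p) env \<longleftrightarrow> sat p (\<lambda>n. env (f n))"
proof (induction p arbitrary: f env)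
  case (AllSet p)
  have "(\<lambda>n. case_nat x env (case_nat 0 (\<lambda>n. Suc (f n)) n)) = case_nat x (\<lambda>n. env (f n))" for x
    by (auto simp: fun_eq_iff split: nat.split)
  then show ?case by (simp add: AllSet.IH)
qed auto

text \<open>
  \<open>P env\<close> may depend on finitely many entries of \<open>env\<close> and on class parameters that do not come
  from \<open>env\<close>; \<open>T n\<close> says which of the two the variable \<open>n\<close> of the formula stands for.
\<close>

definition predicative :: "((nat \<Rightarrow> 'a) \<Rightarrow> bool) \<Rightarrow> bool" where
  "predicative P \<longleftrightarrow> (\<exists>p T. \<forall>env. P env \<longleftrightarrow> sat p (\<lambda>n. case_sum env (\<lambda>a. a) (T n)))"

text \<open>Membership rather than equality describes a class-valued expression, because its value
  may be a proper class, over which no set quantifier ranges. Entry 0 is the prospective member; the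
  entries after it form the environment of \<open>t\<close>.\<close>

definition definable :: "((nat \<Rightarrow> 'a) \<Rightarrow> 'a) \<Rightarrow> bool" where
  "definable t \<longleftrightarrow> predicative (\<lambda>e. e 0 \<epsilon> t (\<lambda>n. e (Suc n)))"

section \<open>Closure under connectives and quantifiers over sets\<close>

lemma predicative_not [predicative_intros]:
  assumes "predicative P" shows "predicative (\<lambda>e. \<not> P e)"
proof -
  obtain p T where "\<forall>env. P env \<longleftrightarrow> sat p (\<lambda>n. case_sum env (\<lambda>a. a) (T n))"
    using assms unfolding predicative_def by blast
  then show ?thesis
    unfolding predicative_def by (intro exI[of _ "Neg p"] exI[of _ T]) simp
qed

lemma predicative_conj [predicative_intros]:
  assumes "predicative P" "predicative Q" shows "predicative (\<lambda>e. P e \<and> Q e)"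
proof -
  obtain p T where p: "\<forall>env. P env \<longleftrightarrow> sat p (\<lambda>n. case_sum env (\<lambda>a. a) (T n))"
    using assms unfolding predicative_def by blast
  obtain q U where q: "\<forall>env. Q env \<longleftrightarrow> sat q (\<lambda>n. case_sum env (\<lambda>a. a) (U n))"
    using assms unfolding predicative_def by blast
  show ?thesis
    unfolding predicative_def
    \<comment> \<open>Even and odd indices keep the variables of \<open>p\<close> and
      \<open>q\<close> apart, so one table holds both \<open>T\<close> and \<open>U\<close>.\<close>
    by (rule exI[of _ "Conj (rename (\<lambda>n. 2 * n) p) (rename (\<lambda>n. Suc (2 * n)) q)"],
        rule exI[of _ "\<lambda>n. if even n then T (n div 2) else U (n div 2)"])
      (simp add: sat_rename p q)
qed

lemma predicative_all [predicative_intros]: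
  assumes "predicative (\<lambda>e. Q (\<lambda>n. e (Suc n)) (e 0))"
  shows "predicative (\<lambda>e. \<forall>\<^sub>S x. Q e x)"
proof -
  obtain p T where p: "\<forall>env. Q (\<lambda>n. env (Suc n)) (env 0) \<longleftrightarrow> sat p (\<lambda>n. case_sum env (\<lambda>a. a) (T n))"
    using assms unfolding predicative_def by blast
  \<comment> \<open>Several variables may stand for entry 0; all of them become the variable bound
    by \<open>AllSet\<close>. The others move up by one under the binder, while the entries they
    stand for move down by one.\<close>
  define f where "f n = (if T n = Inl 0 then 0 else Suc n)" for n
  define U where "U n = map_sum (\<lambda>i. i - 1) (\<lambda>a. a) (T n)" for n
  have eq: "(\<lambda>n. case_nat x (\<lambda>n. case_sum env (\<lambda>a. a) (U n)) (f n))
      = (\<lambda>n. case_sum (case_nat x env) (\<lambda>a. a) (T n))" for x and env :: "nat \<Rightarrow> 'a"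
  proof
    fix n
    show "case_nat x (\<lambda>n. case_sum env (\<lambda>a. a) (U n)) (f n) = case_sum (case_nat x env) (\<lambda>a. a) (T n)"
      by (cases "T n") (auto simp: f_def U_def split: nat.split)
  qed
  have "Q env x \<longleftrightarrow> sat p (\<lambda>n. case_sum (case_nat x env) (\<lambda>a. a) (T n))" for env x
    using p[rule_format, of "case_nat x env"] by simp
  then show ?thesis
    unfolding predicative_def
    by (intro exI[of _ "AllSet (rename f p)"] exI[of _ U]) (simp add: sat_rename eq)
qed

lemma predicative_cong: "(\<And>e. P e \<longleftrightarrow> Q e) \<Longrightarrow> predicative Q \<Longrightarrow> predicative P"
  by presburger

text \<open>Here the entries of the environment are renamed, so only \<open>T\<close> changes;
  \<open>rename\<close> acts on the variables of the formula.\<close>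

lemma predicative_rename:
  assumes "predicative P" shows "predicative (\<lambda>e. P (\<lambda>n. e (f n)))"
proof -
  obtain p T where p: "\<forall>env. P env \<longleftrightarrow> sat p (\<lambda>n. case_sum env (\<lambda>a. a) (T n))"
    using assms unfolding predicative_def by blast
  have eq: "case_sum (\<lambda>n. env (f n)) (\<lambda>a. a) x = case_sum env (\<lambda>a. a) (map_sum f (\<lambda>a. a) x)"
    for x and env :: "nat \<Rightarrow> 'a"
    by (cases x) auto
  show ?thesis
    unfolding predicative_def
    by (intro exI[of _ p] exI[of _ "\<lambda>n. map_sum f (\<lambda>a. a) (T n)"]) (simp add: p eq)
qed

lemma definable_rename:
  assumes "definable t" shows "definable (\<lambda>e. t (\<lambda>n. e (f n)))"
  using predicative_rename[OF assms[unfolded definable_def], of "case_nat 0 (\<lambda>n. Suc (f n))"]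
  by (simp add: definable_def)

lemma predicative_disj [predicative_intros]:
  assumes "predicative P" "predicative Q" shows "predicative (\<lambda>e. P e \<or> Q e)"
  using predicative_not[OF predicative_conj[OF assms[THEN predicative_not]]] by simp

lemma predicative_imp [predicative_intros]:
  assumes "predicative P" "predicative Q" shows "predicative (\<lambda>e. P e \<longrightarrow> Q e)"
  by (rule predicative_cong[OF _ predicative_disj[OF predicative_not[OF assms(1)] assms(2)]]) blast

lemma predicative_iff [predicative_intros]:
  assumes "predicative P" "predicative Q" shows "predicative (\<lambda>e. P e \<longleftrightarrow> Q e)"
  by (rule predicative_cong[OF _ predicative_conj[OF predicative_imp[OF assms] predicative_imp[OF assms(2,1)]]]) blast

lemma predicative_ex [predicative_intros]:
  assumes "predicative (\<lambda>e. Q (\<lambda>n. e (Suc n)) (e 0))"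
  shows "predicative (\<lambda>e. \<exists>\<^sub>S x. Q e x)"
  using predicative_not[OF predicative_all[of "\<lambda>e x. \<not> Q e x", OF predicative_not[OF assms]]] by simp

lemma isset_mem: "x \<epsilon> X \<Longrightarrow> isset x"
  unfolding isset_def by blast

lemma ext_sets: "(\<And>z. isset z \<Longrightarrow> z \<epsilon> X \<longleftrightarrow> z \<epsilon> Y) \<Longrightarrow> X = Y"
  by (meson extensionality isset_mem)

text \<open>The renaming identifies entry 0 in \<open>definable\<close> with entry \<open>i\<close>.
  General equality and membership reduce to this case by a quantifier over sets.\<close>

lemma predicative_mem_var: "definable u \<Longrightarrow> predicative (\<lambda>e. e i \<epsilon> u e)"
  unfolding definable_def
  using predicative_rename[of "\<lambda>e. e 0 \<epsilon> u (\<lambda>n. e (Suc n))" "case_nat i (\<lambda>n. n)"] by simp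

lemma predicative_eq [predicative_intros]:
  assumes "definable t" "definable u" shows "predicative (\<lambda>e. t e = u e)"
proof -
  have "t e = u e \<longleftrightarrow> (\<forall>\<^sub>S x. x \<epsilon> t e \<longleftrightarrow> x \<epsilon> u e)" for e
    using ext_sets[of "t e" "u e"] by auto
  then show ?thesis
    by (rule predicative_cong) (intro predicative_intros predicative_mem_var assms[THEN definable_rename])
qed

lemma definable_var [predicative_intros]: "definable (\<lambda>e. e i)"
  unfolding definable_def predicative_def
  by (intro exI[of _ "Mem 0 (Suc i)"] exI[of _ Inl]) simp

lemma definable_const [predicative_intros]: "definable (\<lambda>e. a)"
  unfolding definable_def predicative_def
  by (intro exI[of _ "Mem 0 1"] exI[of _ "case_nat (Inl 0) (\<lambda>_. Inr a)"]) simp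

lemma predicative_const [predicative_intros]: "predicative (\<lambda>e. B)"
  unfolding predicative_def by (cases B) (auto intro: exI[of _ "Eq 0 0"] exI[of _ "Neg (Eq 0 0)"])

text \<open>A proper class \<open>t e\<close> equals no set \<open>z\<close> and is a member of
  nothing, so a quantifier over sets suffices.\<close>

lemma predicative_mem [predicative_intros]:
  assumes t: "definable t" and u: "definable u" shows "predicative (\<lambda>e. t e \<epsilon> u e)"
proof -
  have "t e \<epsilon> u e \<longleftrightarrow> (\<exists>\<^sub>S z. z = t e \<and> z \<epsilon> u e)" for e
    using isset_mem by blast
  then show ?thesis
    by (rule predicative_cong) (intro predicative_intros predicative_mem_var definable_rename[OF t] definable_rename[OF u])
qed

lemma predicative_isset [predicative_intros]:
  assumes t: "definable t" shows "predicative (\<lambda>e. isset (t e))"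
proof -
  have "isset (t e) \<longleftrightarrow> (\<exists>\<^sub>S z. z = t e)" for e by blast
  then show ?thesis
    by (rule predicative_cong) (intro predicative_intros definable_rename[OF t])
qed

text \<open>HOL's quantifier ranges over all classes; the bound \<open>x \<epsilon> t e\<close>
  confines it to sets, as \<open>AllSet\<close> demands.\<close>

lemma predicative_ball [predicative_intros]:
  assumes "definable t" and "predicative (\<lambda>e. Q (\<lambda>n. e (Suc n)) (e 0))"
  shows "predicative (\<lambda>e. \<forall>x. x \<epsilon> t e \<longrightarrow> Q e x)"
proof -
  have "(\<forall>x. x \<epsilon> t e \<longrightarrow> Q e x) \<longleftrightarrow> (\<forall>\<^sub>S x. x \<epsilon> t e \<longrightarrow> Q e x)" for e
    using isset_mem by blast
  then show ?thesis
    by (rule predicative_cong) (intro predicative_intros assms predicative_mem_var definable_rename[OF assms(1)])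
qed

lemma predicative_bex [predicative_intros]:
  assumes "definable t" and "predicative (\<lambda>e. Q (\<lambda>n. e (Suc n)) (e 0))"
  shows "predicative (\<lambda>e. \<exists>x. x \<epsilon> t e \<and> Q e x)"
proof -
  have "(\<exists>x. x \<epsilon> t e \<and> Q e x) \<longleftrightarrow> (\<exists>\<^sub>S x. x \<epsilon> t e \<and> Q e x)" for e
    using isset_mem by blast
  then show ?thesis
    by (rule predicative_cong) (intro predicative_intros assms predicative_mem_var definable_rename[OF assms(1)])
qed

section \<open>Substitution of definable expressions for variables\<close>

lemma predicative_sat:
  assumes "\<And>n. definable (T n)" shows "predicative (\<lambda>e. sat p (\<lambda>n. T n e))"
  using assms
proof (induction p arbitrary: T)
  case (AllSet p)
  \<comment> \<open>Below the binder, index 0 is the bound variable itself, and the substituted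
    expressions read the environment past it.\<close>
  define U where "U = case_nat (\<lambda>e. e 0) (\<lambda>n e. T n (\<lambda>m. e (Suc m)))"
  have "definable (U n)" for n
    by (cases n) (auto simp: U_def intro: definable_var definable_rename[OF AllSet.prems])
  then have "predicative (\<lambda>e. sat p (\<lambda>n. U n e))" by (rule AllSet.IH)
  moreover have "(\<lambda>n. U n e) = case_nat (e 0) (\<lambda>n. T n (\<lambda>m. e (Suc m)))" for e
    by (auto simp: U_def fun_eq_iff split: nat.split)
  ultimately have "predicative (\<lambda>e. sat p (case_nat (e 0) (\<lambda>n. T n (\<lambda>m. e (Suc m)))))"
    by simp
  then have "predicative (\<lambda>e. \<forall>\<^sub>S x. sat p (case_nat x (\<lambda>n. T n e)))"
    by (rule predicative_all)
  then show ?case by simp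
qed (simp_all add: predicative_mem predicative_eq predicative_not predicative_conj)

lemma predicative_subst:
  assumes "predicative P" "\<And>n. definable (T n)" shows "predicative (\<lambda>e. P (\<lambda>n. T n e))"
proof -
  obtain p U where p: "\<forall>env. P env \<longleftrightarrow> sat p (\<lambda>n. case_sum env (\<lambda>a. a) (U n))"
    using assms unfolding predicative_def by blast
  have eq: "case_sum (\<lambda>n. T n e) (\<lambda>a. a) x = case_sum T (\<lambda>a e. a) x e" for e x
    by (cases x) auto
  have "definable (case_sum T (\<lambda>a e. a) (U n))" for n
    by (cases "U n") (auto intro: assms definable_const)
  from predicative_sat[OF this] show ?thesis
    by (simp add: p eq)
qed

lemma definable_subst:
  assumes "definable u" "\<And>n. definable (T n)" shows "definable (\<lambda>e. u (\<lambda>n. T n e))"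
proof -
  define U where "U = case_nat (\<lambda>e. e 0) (\<lambda>n e. T n (\<lambda>m. e (Suc m)))"
  have "definable (U n)" for n
    by (cases n) (auto simp: U_def intro: definable_var definable_rename[OF assms(2)])
  from predicative_subst[of _ U, OF assms(1)[unfolded definable_def] this] show ?thesis
    by (simp add: definable_def U_def)
qed

text \<open>With these forms a notion is treated once, for the first entries of the environment, and
  is then available at arbitrary definable arguments.\<close>

lemma predicative_subst1:
  assumes "predicative (\<lambda>e. R (e 0))" "definable t" shows "predicative (\<lambda>e. R (t e))"
  using predicative_subst[OF assms(1), of "\<lambda>_. t"] assms(2) by simp

lemma predicative_subst2:
  assumes "predicative (\<lambda>e. R (e 0) (e (Suc 0)))" "definable t" "definable u"
  shows "predicative (\<lambda>e. R (t e) (u e))"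
  using predicative_subst[OF assms(1), of "case_nat t (\<lambda>_. u)"] assms(2,3)
  by (simp split: nat.split)

lemma predicative_subst3:
  assumes "predicative (\<lambda>e. R (e 0) (e (Suc 0)) (e (Suc (Suc 0))))"
    and "definable t" "definable u" "definable v"
  shows "predicative (\<lambda>e. R (t e) (u e) (v e))"
  using predicative_subst[OF assms(1), of "case_nat t (case_nat u (\<lambda>_. v))"] assms(2-4)
  by (simp split: nat.split)

lemma definable_subst1:
  assumes "definable (\<lambda>e. R (e 0))" "definable t" shows "definable (\<lambda>e. R (t e))"
  using definable_subst[OF assms(1), of "\<lambda>_. t"] assms(2) by simp

lemma definable_subst2:
  assumes "definable (\<lambda>e. R (e 0) (e (Suc 0)))" "definable t" "definable u"
  shows "definable (\<lambda>e. R (t e) (u e))"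
  using definable_subst[OF assms(1), of "case_nat t (\<lambda>_. u)"] assms(2,3)
  by (simp split: nat.split)

section \<open>Comprehension for predicative properties\<close>

lemma collects:
  assumes "predicative (\<lambda>e. P (e 0))" shows "\<exists>X. \<forall>x. x \<epsilon> X \<longleftrightarrow> isset x \<and> P x"
proof -
  obtain p T where p: "\<forall>env :: nat \<Rightarrow> 'a. P (env 0) \<longleftrightarrow> sat p (\<lambda>n. case_sum env (\<lambda>a. a) (T n))"
    using assms unfolding predicative_def by blast
  \<comment> \<open>\<open>P\<close> reads only entry 0, so the formula may be evaluated in the
    constant environment \<open>x\<close>: each variable standing for an entry becomes the
    comprehension variable 0, each class parameter a free index. The \<open>undefined\<close> slots
    belong to variables renamed to 0 and are never read.\<close>
  define f where "f n = case_sum (\<lambda>_. 0) (\<lambda>_. Suc n) (T n)" for n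
  define env where "env n = case_sum (\<lambda>_. undefined) (\<lambda>a. a) (T n)" for n
  have eq: "(\<lambda>n. case_nat x env (f n)) = (\<lambda>n. case_sum (\<lambda>_. x) (\<lambda>a. a) (T n))" for x
    by (auto simp: fun_eq_iff f_def env_def split: sum.split)
  have "P x \<longleftrightarrow> sat (rename f p) (case_nat x env)" for x
    using p[rule_format, of "\<lambda>_. x"] by (simp add: sat_rename eq)
  then show ?thesis
    using comprehension[of "rename f p" env] isset_mem by metis
qed

lemma mem_class_of:
  assumes "predicative (\<lambda>e. P (e 0))" shows "x \<epsilon> class_of P \<longleftrightarrow> isset x \<and> P x"
proof -
  obtain X where X: "\<forall>x. x \<epsilon> X \<longleftrightarrow> isset x \<and> P x" using collects[OF assms] by blast
  have "Y = X" if "\<forall>x. x \<epsilon> Y \<longleftrightarrow> isset x \<and> P x" for Y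
    by (rule extensionality) (simp add: X that)
  with X have "class_of P = X"
    unfolding class_of_def by (intro the_equality)
  with X show ?thesis by blast
qed

lemma definable_class_of [predicative_intros]:
  assumes "predicative (\<lambda>e. P (\<lambda>n. e (Suc n)) (e 0))"
  shows "definable (\<lambda>e. CLASS x. P e x)"
proof -
  have "predicative (\<lambda>e'. P e (e' 0))" for e
  proof -
    \<comment> \<open>For one fixed \<open>e\<close> its entries are turned into class parameters,
      which \<open>predicative\<close> admits besides the environment.\<close>
    define U where "U = case_nat (\<lambda>e' :: nat \<Rightarrow> 'a. e' 0) (\<lambda>n _. e n)"
    have "definable (U m)" for m
      by (cases m) (auto simp: U_def intro: definable_var definable_const)
    from predicative_subst[of _ U, OF assms this] show ?thesis by (simp add: U_def)
  qed
  from mem_class_of[OF this]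
  have "y \<epsilon> (CLASS x. P e x) \<longleftrightarrow> isset y \<and> P e y" for y e .
  then show ?thesis
    unfolding definable_def
    by (rule predicative_cong) (intro predicative_intros assms)
qed

section \<open>Basic notions are predicative\<close>

lemma predicative_included [predicative_intros]:
  "definable t \<Longrightarrow> definable u \<Longrightarrow> predicative (\<lambda>e. t e \<sqsubseteq> u e)"
  by (rule predicative_subst2[of included]) (unfold included_def, intro predicative_intros)

lemma definable_upair [predicative_intros]:
  "definable t \<Longrightarrow> definable u \<Longrightarrow> definable (\<lambda>e. upair (t e) (u e))"
  by (rule definable_subst2[of upair]) (unfold upair_def, intro predicative_intros)

lemma definable_opair [predicative_intros]:
  "definable t \<Longrightarrow> definable u \<Longrightarrow> definable (\<lambda>e. \<langle>t e, u e\<rangle>)"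
  by (rule definable_subst2[of opair]) (unfold opair_def, intro predicative_intros)

lemma predicative_is_function [predicative_intros]:
  "definable t \<Longrightarrow> predicative (\<lambda>e. is_function (t e))"
  by (rule predicative_subst1[of is_function]) (unfold is_function_def, intro predicative_intros)

lemma definable_dom [predicative_intros]: "definable t \<Longrightarrow> definable (\<lambda>e. dom (t e))"
  by (rule definable_subst1[of dom]) (unfold dom_def, intro predicative_intros)

lemma definable_succ [predicative_intros]: "definable t \<Longrightarrow> definable (\<lambda>e. succ (t e))"
  by (rule definable_subst1[of succ]) (unfold succ_def, intro predicative_intros)

lemma predicative_transitive [predicative_intros]:
  "definable t \<Longrightarrow> predicative (\<lambda>e. transitive (t e))"
  by (rule predicative_subst1[of transitive]) (unfold transitive_def, intro predicative_intros)

text \<open>In the definition \<open>x\<close> ranges over all classes, but a member of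
  \<open>n\<close> is a set, and \<open>n\<close> itself is one by the first conjunct.\<close>

lemma predicative_is_nat [predicative_intros]: "definable t \<Longrightarrow> predicative (\<lambda>e. is_nat (t e))"
proof (rule predicative_subst1[of is_nat])
  have "is_nat n \<longleftrightarrow> isset n \<and> transitive n \<and> (\<forall>x. x \<epsilon> n \<longrightarrow> transitive x) \<and>
     (\<forall>\<^sub>S x. x \<epsilon> n \<or> x = n \<longrightarrow> x = empty \<or> (\<exists>\<^sub>S y. x = succ y))" for n
    unfolding is_nat_def using isset_mem by blast
  then show "predicative (\<lambda>e. is_nat (e 0))"
    by (rule predicative_cong) (intro predicative_intros)
qed

lemma predicative_is_seq [predicative_intros]:
  "definable t \<Longrightarrow> definable u \<Longrightarrow> predicative (\<lambda>e. is_seq (t e) (u e))"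
  by (rule predicative_subst2[of is_seq]) (unfold is_seq_def, intro predicative_intros)

subsection \<open>Sets, functions and natural numbers\<close>

lemma mem_empty [simp]: "\<not> u \<epsilon> empty"
  unfolding empty_def by (subst mem_class_of) (auto intro!: predicative_intros)

lemma mem_upair: "u \<epsilon> upair x y \<longleftrightarrow> isset u \<and> (u = x \<or> u = y)"
  unfolding upair_def by (rule mem_class_of) (intro predicative_intros)

lemma mem_dom: "x \<epsilon> dom F \<longleftrightarrow> isset x \<and> (\<exists>\<^sub>S y. \<langle>x, y\<rangle> \<epsilon> F)"
  unfolding dom_def by (rule mem_class_of) (intro predicative_intros)

lemma mem_succ: "isset n \<Longrightarrow> u \<epsilon> succ n \<longleftrightarrow> u \<epsilon> n \<or> u = n"
  unfolding succ_def by (subst mem_class_of) (auto intro!: predicative_intros dest: isset_mem)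

lemma mem_interp: "u \<epsilon> interp \<SS> X \<longleftrightarrow> isset u \<and> \<langle>X, u\<rangle> \<epsilon> \<SS>"
  unfolding interp_def by (rule mem_class_of) (intro predicative_intros)

lemma isset_upair: "isset x \<Longrightarrow> isset y \<Longrightarrow> isset (upair x y)"
proof -
  assume "isset x" "isset y"
  then obtain z where "isset z" "\<forall>u. u \<epsilon> z \<longleftrightarrow> u = x \<or> u = y" using pairing by blast
  moreover from this have "z = upair x y"
    using \<open>isset x\<close> \<open>isset y\<close> by (intro ext_sets) (auto simp: mem_upair)
  ultimately show ?thesis by simp
qed

lemma isset_opair [simp]: "isset x \<Longrightarrow> isset y \<Longrightarrow> isset \<langle>x, y\<rangle>"
  unfolding opair_def by (simp add: isset_upair)

text \<open>The second components may be proper classes here, in which case \<open>upair\<close> drops them.\<close>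

lemma opair_eq_fst: "\<langle>x, y\<rangle> = \<langle>x', y'\<rangle> \<Longrightarrow> isset x \<Longrightarrow> isset x' \<Longrightarrow> x = x'"
  unfolding opair_def by (metis mem_upair isset_upair)

lemma opair_eq_iff [simp]:
  "isset x \<Longrightarrow> isset y \<Longrightarrow> isset x' \<Longrightarrow> isset y' \<Longrightarrow> \<langle>x, y\<rangle> = \<langle>x', y'\<rangle> \<longleftrightarrow> x = x' \<and> y = y'"
proof
  assume s: "isset x" "isset y" "isset x'" "isset y'" and eq: "\<langle>x, y\<rangle> = \<langle>x', y'\<rangle>"
  have x: "x = x'" using opair_eq_fst eq s by blast
  have "upair x y = upair x x \<or> upair x y = upair x y'" "upair x y' = upair x x \<or> upair x y' = upair x y"
    using eq s x unfolding opair_def by (metis mem_upair isset_upair)+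
  then have "y = y'" using s by (metis mem_upair)
  with x show "x = x' \<and> y = y'" by blast
qed simp

lemma is_functionI:
  assumes "\<And>p. p \<epsilon> F \<Longrightarrow> \<exists>\<^sub>S x y. p = \<langle>x, y\<rangle>"
    and "\<And>x y z. isset x \<Longrightarrow> isset y \<Longrightarrow> isset z \<Longrightarrow> \<langle>x, y\<rangle> \<epsilon> F \<Longrightarrow> \<langle>x, z\<rangle> \<epsilon> F \<Longrightarrow> y = z"
  shows "is_function F"
  unfolding is_function_def using assms by blast

section \<open>Replacement, Separation and Foundation for predicative properties\<close>

lemma set_image:
  assumes a: "isset a" and R: "predicative (\<lambda>e. R (e 0) (e (Suc 0)))"
    and unique: "\<And>x y z. x \<epsilon> a \<Longrightarrow> isset y \<Longrightarrow> isset z \<Longrightarrow> R x y \<Longrightarrow> R x z \<Longrightarrow> y = z"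
  shows "\<exists>\<^sub>S b. \<forall>y. y \<epsilon> b \<longleftrightarrow> isset y \<and> (\<exists>x. x \<epsilon> a \<and> R x y)"
proof -
  \<comment> \<open>Functionality of \<open>R\<close> is assumed on \<open>a\<close> only, so the
    class handed to Replacement is restricted to first components in \<open>a\<close>.\<close>
  have "predicative (\<lambda>e. \<exists>x. x \<epsilon> a \<and> (\<exists>\<^sub>S y. e 0 = \<langle>x, y\<rangle> \<and> R x y))"
    by (intro predicative_intros predicative_subst2[OF R])
  from collects[OF this] obtain F where
    F: "\<forall>p. p \<epsilon> F \<longleftrightarrow> isset p \<and> (\<exists>x. x \<epsilon> a \<and> (\<exists>\<^sub>S y. p = \<langle>x, y\<rangle> \<and> R x y))" by blast
  have mem: "\<langle>x, y\<rangle> \<epsilon> F \<longleftrightarrow> x \<epsilon> a \<and> R x y" if "isset x" "isset y" for x y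
    using that F by (metis opair_eq_iff isset_mem isset_opair)
  have "is_function F"
  proof (rule is_functionI)
    show "\<exists>\<^sub>S x y. p = \<langle>x, y\<rangle>" if "p \<epsilon> F" for p using F that isset_mem by metis
    show "y = z" if "isset x" "isset y" "isset z" "\<langle>x, y\<rangle> \<epsilon> F" "\<langle>x, z\<rangle> \<epsilon> F" for x y z
      using that mem unique by blast
  qed
  from replacement[OF this a] obtain b where
    b: "isset b" "\<forall>\<^sub>S y. y \<epsilon> b \<longleftrightarrow> (\<exists>x. x \<epsilon> a \<and> \<langle>x, y\<rangle> \<epsilon> F)" by blast
  then have "\<forall>y. y \<epsilon> b \<longleftrightarrow> isset y \<and> (\<exists>x. x \<epsilon> a \<and> R x y)"
    using mem isset_mem by metis
  with b(1) show ?thesis by blast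
qed

text \<open>Replacement admits partial functions, so the identity on the members satisfying
  \<open>P\<close> yields Separation.\<close>

lemma separation:
  assumes "isset a" and "predicative (\<lambda>e. P (e 0))"
  shows "\<exists>\<^sub>S b. \<forall>y. y \<epsilon> b \<longleftrightarrow> y \<epsilon> a \<and> P y"
proof -
  have "predicative (\<lambda>e. P (e 0) \<and> e 0 = e (Suc 0))"
    by (intro predicative_intros assms)
  then have "\<exists>\<^sub>S b. \<forall>y. y \<epsilon> b \<longleftrightarrow> isset y \<and> (\<exists>x. x \<epsilon> a \<and> P x \<and> x = y)"
    by (rule set_image[OF assms(1), where R = "\<lambda>x y. P x \<and> x = y"]) simp
  then obtain b where "isset b" "\<forall>y. y \<epsilon> b \<longleftrightarrow> isset y \<and> (\<exists>x. x \<epsilon> a \<and> P x \<and> x = y)" by blast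
  then show ?thesis using isset_mem by metis
qed

lemma set_insert:
  assumes "isset a" "isset c" shows "\<exists>\<^sub>S b. \<forall>y. y \<epsilon> b \<longleftrightarrow> y \<epsilon> a \<or> y = c"
proof -
  obtain b where b: "isset b" "\<forall>u. u \<epsilon> b \<longleftrightarrow> (\<exists>y. y \<epsilon> upair a (upair c c) \<and> u \<epsilon> y)"
    using union[OF isset_upair[OF assms(1) isset_upair[OF assms(2,2)]]] by blast
  then have "\<forall>y. y \<epsilon> b \<longleftrightarrow> y \<epsilon> a \<or> y = c"
    using assms isset_upair[OF assms(2,2)] by (auto simp: mem_upair)
  with b(1) show ?thesis by blast
qed

text \<open>Foundation is available for sets only, so the members with property \<open>P\<close> are
  first cut out of a given set. Both \<open>is_nat_induct\<close> and \<open>term_induct\<close>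
  rest on this.\<close>

lemma set_minimal:
  assumes "isset a" and P: "predicative (\<lambda>e. P (e 0))" and "x \<epsilon> a" "P x"
  shows "\<exists>m. m \<epsilon> a \<and> P m \<and> (\<forall>y. y \<epsilon> m \<and> y \<epsilon> a \<longrightarrow> \<not> P y)"
proof -
  obtain b where b: "isset b" "\<forall>y. y \<epsilon> b \<longleftrightarrow> y \<epsilon> a \<and> P y"
    using separation[OF assms(1) P] by blast
  with foundation[OF b(1)] assms(3,4) show ?thesis by metis
qed

lemma not_mem_self: "\<not> x \<epsilon> x"
proof
  assume x: "x \<epsilon> x"
  then have "isset x" by (rule isset_mem)
  with foundation[OF isset_upair[of x x]] x show False by (auto simp: mem_upair)
qed

lemma not_mem_cycle: "x \<epsilon> y \<Longrightarrow> \<not> y \<epsilon> x"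
proof
  assume xy: "x \<epsilon> y" "y \<epsilon> x"
  then have "isset x" "isset y" by (auto dest: isset_mem)
  with foundation[OF isset_upair[of x y]] xy show False by (auto simp: mem_upair)
qed

lemma isset_empty [simp]: "isset empty"
proof -
  obtain x where "isset x" using set_exists by blast
  from separation[OF this, of "\<lambda>_. False"] obtain b where "isset b" "\<forall>y. \<not> y \<epsilon> b"
    by (auto intro: predicative_intros)
  moreover from this have "b = empty" by (intro extensionality) auto
  ultimately show ?thesis by simp
qed

lemma isset_succ [simp]: "isset n \<Longrightarrow> isset (succ n)"
proof -
  assume n: "isset n"
  then obtain b where "isset b" "\<forall>y. y \<epsilon> b \<longleftrightarrow> y \<epsilon> n \<or> y = n" using set_insert by blast
  moreover from this n have "b = succ n" by (intro extensionality) (auto simp: mem_succ)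
  ultimately show ?thesis by simp
qed

lemma isset_num [simp]: "isset (num k)"
  by (induction k) auto

lemma num_mem_num: "i < j \<Longrightarrow> num i \<epsilon> num j"
  by (induction j) (auto simp: mem_succ less_Suc_eq)

lemma num_eq_iff [simp]: "num i = num j \<longleftrightarrow> i = j"
  using num_mem_num not_mem_self by (metis linorder_neqE_nat)

text \<open>If \<open>m\<close> and \<open>n\<close> differed, each would be a member of the other,
  a cycle that Foundation rules out.\<close>

lemma succ_inj: "isset m \<Longrightarrow> isset n \<Longrightarrow> succ m = succ n \<Longrightarrow> m = n"
  by (metis mem_succ not_mem_cycle)

lemma succ_neq_empty: "isset n \<Longrightarrow> succ n \<noteq> empty"
  by (metis mem_succ mem_empty)

section \<open>Application and sequences\<close>

lemma app_eq: "is_function F \<Longrightarrow> \<langle>x, y\<rangle> \<epsilon> F \<Longrightarrow> isset x \<Longrightarrow> isset y \<Longrightarrow> F \<bullet> x = y"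
  unfolding app_def is_function_def by (rule the_equality) blast+

lemma app_pair:
  assumes "is_function F" "x \<epsilon> dom F" shows "\<langle>x, F \<bullet> x\<rangle> \<epsilon> F" "isset (F \<bullet> x)"
  using assms app_eq[of F x] unfolding mem_dom by metis+

text \<open>Since \<open>app\<close> is not predicative outside the domain of a function, it is replaced by
  \<open>val\<close> when a class is to be formed.\<close>

definition val :: "'a \<Rightarrow> 'a \<Rightarrow> 'a" where
  "val F x = (CLASS u. \<exists>\<^sub>S y. \<langle>x, y\<rangle> \<epsilon> F \<and> u \<epsilon> y)"

lemma app_eq_val:
  assumes "is_function F" "x \<epsilon> dom F" shows "F \<bullet> x = val F x"
proof (rule ext_sets)
  fix u assume "isset u"
  have "u \<epsilon> val F x \<longleftrightarrow> isset u \<and> (\<exists>\<^sub>S y. \<langle>x, y\<rangle> \<epsilon> F \<and> u \<epsilon> y)"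
    unfolding val_def by (rule mem_class_of) (intro predicative_intros)
  moreover have "isset x" using assms(2) by (rule isset_mem)
  ultimately show "u \<epsilon> F \<bullet> x \<longleftrightarrow> u \<epsilon> val F x"
    using app_pair[OF assms] app_eq[OF assms(1), of x] \<open>isset u\<close> by metis
qed

lemma definable_val [predicative_intros]:
  "definable t \<Longrightarrow> definable u \<Longrightarrow> definable (\<lambda>e. val (t e) (u e))"
  by (rule definable_subst2[of val]) (unfold val_def, intro predicative_intros)

lemma seq_app:
  assumes "is_seq n s" "i \<epsilon> n"
  shows "\<langle>i, s \<bullet> i\<rangle> \<epsilon> s" "isset (s \<bullet> i)" "s \<bullet> i = val s i"
  using assms app_pair app_eq_val unfolding is_seq_def by auto

lemma is_function_eqI:
  assumes F: "is_function F" and G: "is_function G" and "dom F = dom G"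
    and eq: "\<And>x. x \<epsilon> dom F \<Longrightarrow> F \<bullet> x = G \<bullet> x"
  shows "F = G"
proof -
  have "p \<epsilon> G" if h: "is_function F" "is_function G" "dom F = dom G"
    "\<And>x. x \<epsilon> dom F \<Longrightarrow> F \<bullet> x = G \<bullet> x" "p \<epsilon> F" for p F G
  proof -
    obtain x y where p: "isset x" "isset y" "p = \<langle>x, y\<rangle>"
      using h(1,5) unfolding is_function_def by blast
    then have "x \<epsilon> dom F" "F \<bullet> x = y" using h(1,5) by (auto simp: mem_dom intro: app_eq)
    with h(2-4) p app_pair(1)[of G x] show ?thesis by simp
  qed
  from this[of F G] this[of G F] assms show ?thesis by (intro extensionality) metis
qed

lemma seq_eqI: "is_seq n s \<Longrightarrow> is_seq n t \<Longrightarrow> (\<And>i. i \<epsilon> n \<Longrightarrow> s \<bullet> i = t \<bullet> i) \<Longrightarrow> s = t"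
  unfolding is_seq_def by (auto intro: is_function_eqI)

text \<open>Uniqueness of the value stands in for Choice: the pairs
  \<open>\<langle>x, y\<rangle>\<close> are the image of \<open>a\<close> under a functional
  relation, hence form a set by Replacement.\<close>

lemma seq_exists:
  assumes a: "isset a" and R: "predicative (\<lambda>e. R (e 0) (e (Suc 0)))"
    and ex: "\<And>x. x \<epsilon> a \<Longrightarrow> \<exists>\<^sub>S y. R x y"
    and unique: "\<And>x y z. x \<epsilon> a \<Longrightarrow> isset y \<Longrightarrow> isset z \<Longrightarrow> R x y \<Longrightarrow> R x z \<Longrightarrow> y = z"
  shows "\<exists>s. is_seq a s \<and> (\<forall>x. x \<epsilon> a \<longrightarrow> R x (s \<bullet> x))"
proof -
  have "predicative (\<lambda>e. \<exists>\<^sub>S y. R (e 0) y \<and> e (Suc 0) = \<langle>e 0, y\<rangle>)"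
    by (intro predicative_intros predicative_subst2[OF R])
  then have "\<exists>\<^sub>S s. \<forall>p. p \<epsilon> s \<longleftrightarrow> isset p \<and> (\<exists>x. x \<epsilon> a \<and> (\<exists>\<^sub>S y. R x y \<and> p = \<langle>x, y\<rangle>))"
    by (rule set_image[OF a, where R = "\<lambda>x p. \<exists>\<^sub>S y. R x y \<and> p = \<langle>x, y\<rangle>"]) (use unique in blast)
  then obtain s where s: "isset s"
    "\<forall>p. p \<epsilon> s \<longleftrightarrow> isset p \<and> (\<exists>x. x \<epsilon> a \<and> (\<exists>\<^sub>S y. R x y \<and> p = \<langle>x, y\<rangle>))" by blast
  have mem: "\<langle>x, y\<rangle> \<epsilon> s \<longleftrightarrow> x \<epsilon> a \<and> R x y" if "isset x" "isset y" for x y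
    using that s(2) by (metis opair_eq_iff isset_mem isset_opair)
  have f: "is_function s"
  proof (rule is_functionI)
    show "\<exists>\<^sub>S x y. p = \<langle>x, y\<rangle>" if "p \<epsilon> s" for p using s(2) that isset_mem by metis
    show "y = z" if "isset x" "isset y" "isset z" "\<langle>x, y\<rangle> \<epsilon> s" "\<langle>x, z\<rangle> \<epsilon> s" for x y z
      using that mem unique by blast
  qed
  moreover have d: "dom s = a"
  proof (rule ext_sets)
    fix x assume x: "isset x"
    show "x \<epsilon> dom s \<longleftrightarrow> x \<epsilon> a" unfolding mem_dom using x mem ex by blast
  qed
  moreover have "R x (s \<bullet> x)" if "x \<epsilon> a" for x
    using app_pair[OF f, of x] that d mem isset_mem by auto
  ultimately show ?thesis using s(1) unfolding is_seq_def by blast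
qed

section \<open>Internal natural numbers and their induction\<close>

lemma transitive_succ: "isset n \<Longrightarrow> transitive n \<Longrightarrow> transitive (succ n)"
  unfolding transitive_def included_def by (auto simp: mem_succ)

lemma transitiveD: "transitive n \<Longrightarrow> x \<epsilon> y \<Longrightarrow> y \<epsilon> n \<Longrightarrow> x \<epsilon> n"
  unfolding transitive_def included_def by blast

lemma is_nat_isset: "is_nat n \<Longrightarrow> isset n"
  unfolding is_nat_def by blast

lemma is_nat_transitive: "is_nat n \<Longrightarrow> transitive n"
  unfolding is_nat_def by blast

lemma is_nat_empty: "is_nat empty"
  unfolding is_nat_def transitive_def by simp

lemma is_nat_succ: "is_nat n \<Longrightarrow> is_nat (succ n)"
  unfolding is_nat_def by (auto simp: mem_succ transitive_succ)

lemma is_nat_mem: "is_nat n \<Longrightarrow> x \<epsilon> n \<Longrightarrow> is_nat x"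
  unfolding is_nat_def by (meson isset_mem transitiveD)

lemma is_nat_cases: "is_nat n \<Longrightarrow> n = empty \<or> (\<exists>m. is_nat m \<and> n = succ m)"
proof -
  assume n: "is_nat n"
  then have "n = empty \<or> (\<exists>\<^sub>S m. n = succ m)" unfolding is_nat_def by blast
  moreover have "is_nat m" if "isset m" "n = succ m" for m
    using is_nat_mem[OF n] that by (simp add: mem_succ)
  ultimately show ?thesis by blast
qed

text \<open>Without Infinity the natural numbers need not form a set, so the minimal counterexample
  is taken in \<open>succ n\<close>, the set of numbers up to \<open>n\<close>.\<close>

lemma is_nat_induct:
  assumes n: "is_nat n" and P: "predicative (\<lambda>e. P (e 0))" and "P empty"
    and step: "\<And>k. is_nat k \<Longrightarrow> P k \<Longrightarrow> P (succ k)"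
  shows "P n"
proof (rule ccontr)
  assume "\<not> P n"
  note s = is_nat_isset[OF n]
  obtain m where m: "m \<epsilon> succ n" "\<not> P m" "\<forall>y. y \<epsilon> m \<and> y \<epsilon> succ n \<longrightarrow> \<not> \<not> P y"
    using set_minimal[OF isset_succ[OF s] predicative_not[OF P], of n] \<open>\<not> P n\<close> s
    by (auto simp: mem_succ)
  then have nat: "is_nat m" using n is_nat_mem s by (auto simp: mem_succ)
  with \<open>P empty\<close> m(2) obtain k where k: "is_nat k" "m = succ k" using is_nat_cases by blast
  then have "k \<epsilon> m" using is_nat_isset mem_succ by blast
  \<comment> \<open>Minimality speaks only of members of \<open>succ n\<close>; transitivity keeps
    the predecessor there.\<close>
  moreover have "k \<epsilon> succ n"
    using transitiveD[OF transitive_succ[OF s is_nat_transitive[OF n]]] \<open>k \<epsilon> m\<close> m(1) by blast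
  ultimately have "P k" using m(3) by blast
  with step k m(2) show False by blast
qed

lemma empty_mem_succ: "is_nat n \<Longrightarrow> empty \<epsilon> succ n"
  by (rule is_nat_induct[where P = "\<lambda>n. empty \<epsilon> succ n"])
    (auto intro!: predicative_intros simp: mem_succ is_nat_isset)

lemma succ_mem_succ: "is_nat n \<Longrightarrow> k \<epsilon> n \<Longrightarrow> succ k \<epsilon> succ n"
proof -
  have "is_nat n \<Longrightarrow> \<forall>k. k \<epsilon> n \<longrightarrow> succ k \<epsilon> succ n"
    by (rule is_nat_induct[where P = "\<lambda>n. \<forall>k. k \<epsilon> n \<longrightarrow> succ k \<epsilon> succ n"], assumption)
      (intro predicative_intros, auto simp: mem_succ is_nat_isset)
  then show "is_nat n \<Longrightarrow> k \<epsilon> n \<Longrightarrow> succ k \<epsilon> succ n" by blast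
qed

text \<open>Both alternatives, \<open>succ k \<epsilon> n\<close> and \<open>succ k = n\<close>, put
  \<open>k\<close> into \<open>n\<close>, the first by transitivity.\<close>

lemma mem_of_succ_mem_succ:
  assumes "is_nat n" "isset k" "succ k \<epsilon> succ n" shows "k \<epsilon> n"
proof -
  have "k \<epsilon> succ k" "isset n" using assms(1,2) by (simp_all add: mem_succ is_nat_isset)
  with assms(3) transitiveD[OF is_nat_transitive[OF assms(1)] \<open>k \<epsilon> succ k\<close>] show ?thesis
    by (auto simp: mem_succ)
qed

subsection \<open>Terms and their subexpressions\<close>

text \<open>Numerals now serve as tags and stay folded: rewriting them to \<open>empty\<close> and
  successors would hide them from \<open>num_eq_iff\<close> and \<open>tag_neq\<close>.\<close>

declare num.simps [simp del]

text \<open>Arguments such as \<open>d\<close> in \<open>immediate_sub\<close> are not known to be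
  sets; comparing first components still separates the tags.\<close>

lemma tag_neq [simp]: "i \<noteq> j \<Longrightarrow> \<langle>num i, x\<rangle> \<noteq> \<langle>num j, y\<rangle>"
  using opair_eq_fst by fastforce

lemmas expression_defs = VarE_def OpE_def DomE_def PredE_def EqE_def NegE_def AndE_def OrE_def
  ImpE_def IffE_def AllE_def ExE_def

lemma isset_OpE [simp]: "isset f \<Longrightarrow> isset t \<Longrightarrow> isset (OpE f t)"
  by (simp add: OpE_def)

lemma OpE_eq_iff [simp]:
  "isset f \<Longrightarrow> isset t \<Longrightarrow> isset f' \<Longrightarrow> isset t' \<Longrightarrow> OpE f t = OpE f' t' \<longleftrightarrow> f = f' \<and> t = t'"
  by (simp add: OpE_def)

lemma is_var_neq_OpE [simp]: "is_var e \<Longrightarrow> e \<noteq> OpE f t"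
  by (auto simp: is_var_def expression_defs)

lemma isset_var: "is_var e \<Longrightarrow> isset e"
  by (auto simp: is_var_def VarE_def is_nat_isset)

lemma isset_seq: "is_seq n s \<Longrightarrow> isset s"
  unfolding is_seq_def by blast

lemma isset_op_symbol: "op_symbol \<rho> f n \<Longrightarrow> isset f" "op_symbol \<rho> f n \<Longrightarrow> isset n"
  unfolding op_symbol_def by blast+

lemma definable_OpE [predicative_intros]:
  "definable t \<Longrightarrow> definable u \<Longrightarrow> definable (\<lambda>e. OpE (t e) (u e))"
  unfolding OpE_def by (intro predicative_intros)

lemma predicative_is_var [predicative_intros]: "definable t \<Longrightarrow> predicative (\<lambda>e. is_var (t e))"
proof (rule predicative_subst1[of is_var])
  have "is_var x \<longleftrightarrow> (\<exists>\<^sub>S n. is_nat n \<and> x = VarE n)" for x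
    unfolding is_var_def using is_nat_isset by blast
  then show "predicative (\<lambda>e. is_var (e 0))"
    by (rule predicative_cong) (unfold VarE_def, intro predicative_intros)
qed

lemma predicative_op_symbol [predicative_intros]:
  "definable t \<Longrightarrow> definable u \<Longrightarrow> predicative (\<lambda>e. op_symbol \<rho> (t e) (u e))"
  unfolding op_symbol_def by (intro predicative_intros)

text \<open>On a sequence every value is a set and equals \<open>val\<close>, so the unrestricted
  quantifiers over \<open>i\<close>, \<open>j\<close> and \<open>x\<close> can be replaced by
  quantifiers over sets. If \<open>f\<close> is not a sequence, both forms fail.\<close>

lemma predicative_is_finite [predicative_intros]:
  "definable t \<Longrightarrow> predicative (\<lambda>e. is_finite (t e))"
proof (rule predicative_subst1[of is_finite])
  have "(is_nat n \<and> is_seq n f \<and>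
        (\<forall>i j. i \<epsilon> n \<and> j \<epsilon> n \<and> f \<bullet> i = f \<bullet> j \<longrightarrow> i = j) \<and>
        (\<forall>x. x \<epsilon> a \<longleftrightarrow> (\<exists>i. i \<epsilon> n \<and> x = f \<bullet> i))) \<longleftrightarrow>
      (is_nat n \<and> is_seq n f \<and>
        (\<forall>i. i \<epsilon> n \<longrightarrow> (\<forall>j. j \<epsilon> n \<longrightarrow> val f i = val f j \<longrightarrow> i = j)) \<and>
        (\<forall>\<^sub>S x. x \<epsilon> a \<longleftrightarrow> (\<exists>i. i \<epsilon> n \<and> x = val f i)))" for n f a
  proof (cases "is_seq n f")
    case True
    then have eq: "f \<bullet> i = val f i" and set: "isset (val f i)" if "i \<epsilon> n" for i
      using seq_app[OF True that] by simp_all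
    have "(\<forall>i j. i \<epsilon> n \<and> j \<epsilon> n \<and> f \<bullet> i = f \<bullet> j \<longrightarrow> i = j) \<longleftrightarrow>
        (\<forall>i. i \<epsilon> n \<longrightarrow> (\<forall>j. j \<epsilon> n \<longrightarrow> val f i = val f j \<longrightarrow> i = j))"
      by (simp add: eq cong: conj_cong) blast
    moreover have "(\<exists>i. i \<epsilon> n \<and> x = f \<bullet> i) \<longleftrightarrow> (\<exists>i. i \<epsilon> n \<and> x = val f i)" for x
      by (simp add: eq cong: conj_cong)
    moreover have "(\<forall>x. x \<epsilon> a \<longleftrightarrow> (\<exists>i. i \<epsilon> n \<and> x = val f i)) \<longleftrightarrow>
        (\<forall>\<^sub>S x. x \<epsilon> a \<longleftrightarrow> (\<exists>i. i \<epsilon> n \<and> x = val f i))"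
      using set isset_mem by blast
    ultimately show ?thesis by simp
  qed simp
  then have "is_finite a \<longleftrightarrow> isset a \<and> (\<exists>\<^sub>S n f. is_nat n \<and> is_seq n f \<and>
        (\<forall>i. i \<epsilon> n \<longrightarrow> (\<forall>j. j \<epsilon> n \<longrightarrow> val f i = val f j \<longrightarrow> i = j)) \<and>
        (\<forall>\<^sub>S x. x \<epsilon> a \<longleftrightarrow> (\<exists>i. i \<epsilon> n \<and> x = val f i)))" for a
    unfolding is_finite_def by (simp only:)
  then show "predicative (\<lambda>e. is_finite (e 0))"
    by (rule predicative_cong) (intro predicative_intros)
qed

text \<open>The predicative form of \<open>term_step\<close> at the index \<open>i\<close> of a formation sequence \<open>s\<close>.\<close>

definition term_entry :: "'a \<Rightarrow> 'a \<Rightarrow> 'a \<Rightarrow> bool" where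
  "term_entry \<rho> s i \<longleftrightarrow> is_var (val s i) \<or>
     (\<exists>\<^sub>S f m t. op_symbol \<rho> f m \<and> is_seq m t \<and>
        (\<forall>k. k \<epsilon> m \<longrightarrow> (\<exists>j. j \<epsilon> i \<and> val t k = val s j)) \<and> val s i = OpE f t)"

definition term_formation :: "'a \<Rightarrow> 'a \<Rightarrow> 'a \<Rightarrow> bool" where
  "term_formation \<rho> n s \<longleftrightarrow> is_nat n \<and> is_seq (succ n) s \<and> (\<forall>i. i \<epsilon> succ n \<longrightarrow> term_entry \<rho> s i)"

lemma is_nat_mem_trans: "is_nat n \<Longrightarrow> j \<epsilon> i \<Longrightarrow> i \<epsilon> succ n \<Longrightarrow> j \<epsilon> succ n"
  using transitiveD[OF is_nat_transitive[OF is_nat_succ]] by blast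

text \<open>\<open>formed\<close> hands \<open>term_step\<close> a HOL predicate for the earlier
  entries. With the sequence itself as argument the condition becomes predicative, since
  \<open>app\<close> and \<open>val\<close> agree at every index in \<open>succ n\<close>.\<close>

lemma is_term_iff: "is_term \<rho> e \<longleftrightarrow> (\<exists>\<^sub>S n s. term_formation \<rho> n s \<and> val s n = e)"
proof -
  have "(is_nat n \<and> is_seq (succ n) s \<and> s \<bullet> n = e \<and>
      (\<forall>i. i \<epsilon> succ n \<longrightarrow> term_step \<rho> (\<lambda>d. \<exists>j. j \<epsilon> i \<and> d = s \<bullet> j) (s \<bullet> i))) \<longleftrightarrow>
    (term_formation \<rho> n s \<and> val s n = e)" for n s
  proof (cases "is_nat n \<and> is_seq (succ n) s")
    case True
    then have n: "is_nat n" and s: "is_seq (succ n) s" by auto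
    have eq: "s \<bullet> i = val s i" if "i \<epsilon> succ n" for i
      using seq_app[OF s that] by simp
    have "term_step \<rho> (\<lambda>d. \<exists>j. j \<epsilon> i \<and> d = s \<bullet> j) (s \<bullet> i) \<longleftrightarrow> term_entry \<rho> s i"
      if i: "i \<epsilon> succ n" for i
    proof -
      have "(op_symbol \<rho> f m \<and> is_seq m t \<and> (\<forall>k. k \<epsilon> m \<longrightarrow> (\<exists>j. j \<epsilon> i \<and> t \<bullet> k = s \<bullet> j)) \<and> s \<bullet> i = OpE f t) \<longleftrightarrow>
        (isset f \<and> isset m \<and> isset t \<and> op_symbol \<rho> f m \<and> is_seq m t \<and>
          (\<forall>k. k \<epsilon> m \<longrightarrow> (\<exists>j. j \<epsilon> i \<and> val t k = val s j)) \<and> val s i = OpE f t)" for f m t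
        using eq[OF i] eq[OF is_nat_mem_trans[OF n _ i]] seq_app(3)[of m t] isset_op_symbol isset_seq
        by (metis (no_types, lifting))
      then show ?thesis
        unfolding term_step_def term_entry_def eq[OF i, symmetric] by (simp add: eq[OF i])
    qed
    moreover have "n \<epsilon> succ n" using n by (simp add: mem_succ is_nat_isset)
    ultimately show ?thesis using True eq unfolding term_formation_def by auto
  qed (auto simp: term_formation_def)
  then show ?thesis unfolding is_term_def formed_def by simp
qed

lemma predicative_is_term [predicative_intros]:
  "definable t \<Longrightarrow> predicative (\<lambda>e. is_term \<rho> (t e))"
  by (rule predicative_subst1[of "is_term \<rho>"])
    (unfold is_term_iff term_formation_def term_entry_def, intro predicative_intros)

text \<open>Entry \<open>i\<close> refers only to itself and to earlier entries, so cutting the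
  sequence after index \<open>j\<close> leaves a formation sequence. The restriction
  \<open>r\<close> is a set by Replacement.\<close>

lemma term_formation_prefix:
  assumes "term_formation \<rho> n s" and j: "j \<epsilon> succ n" shows "is_term \<rho> (val s j)"
proof -
  have n: "is_nat n" and s: "is_seq (succ n) s" and entry: "\<And>i. i \<epsilon> succ n \<Longrightarrow> term_entry \<rho> s i"
    using assms(1) unfolding term_formation_def by blast+
  have nat: "is_nat j" using n j is_nat_mem is_nat_succ by blast
  then have isset: "isset j" by (rule is_nat_isset)
  have sub: "i \<epsilon> succ n" if "i \<epsilon> succ j" for i
    using that j is_nat_mem_trans[OF n] isset by (auto simp: mem_succ)
  have "\<exists>r. is_seq (succ j) r \<and> (\<forall>i. i \<epsilon> succ j \<longrightarrow> r \<bullet> i = val s i)"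
  proof (rule seq_exists)
    show "\<exists>\<^sub>S y. y = val s i" if "i \<epsilon> succ j" for i using seq_app[OF s sub[OF that]] by auto
  qed (auto simp: isset intro!: predicative_intros)
  then obtain r where r: "is_seq (succ j) r" "\<And>i. i \<epsilon> succ j \<Longrightarrow> val r i = val s i"
    using seq_app(3) by metis
  have "term_entry \<rho> r i" if i: "i \<epsilon> succ j" for i
  proof -
    have "val r k = val s k" if "k \<epsilon> i" for k using r(2) is_nat_mem_trans[OF nat that i] by blast
    then show ?thesis
      using entry[OF sub[OF i]] r(2)[OF i] unfolding term_entry_def by (metis (no_types, lifting))
  qed
  moreover have "val r j = val s j" using r(2) isset by (simp add: mem_succ)
  ultimately show ?thesis
    unfolding is_term_iff term_formation_def using nat isset r(1) isset_seq by blast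
qed

lemma isset_term: "is_term \<rho> e \<Longrightarrow> isset e"
proof -
  assume "is_term \<rho> e"
  then obtain n s where "is_nat n" "is_seq (succ n) s" "val s n = e"
    unfolding is_term_iff term_formation_def by blast
  then show ?thesis using seq_app[of "succ n" s n] by (auto simp: mem_succ is_nat_isset)
qed

text \<open>\<open>D\<close> is the range of the whole formation sequence and may contain terms that
  are not subterms of \<open>e\<close>, even terms with further variables.\<close>

lemma term_closure:
  assumes "is_term \<rho> e"
  shows "\<exists>\<^sub>S D. e \<epsilon> D \<and> (\<forall>d. d \<epsilon> D \<longrightarrow> is_term \<rho> d) \<and>
    (\<forall>f n t. op_symbol \<rho> f n \<and> is_seq n t \<and> OpE f t \<epsilon> D \<longrightarrow> (\<forall>k. k \<epsilon> n \<longrightarrow> t \<bullet> k \<epsilon> D))"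
proof -
  obtain n s where ns: "term_formation \<rho> n s" "val s n = e"
    using assms unfolding is_term_iff by blast
  then have n: "is_nat n" and s: "is_seq (succ n) s" and entry: "\<And>i. i \<epsilon> succ n \<Longrightarrow> term_entry \<rho> s i"
    unfolding term_formation_def by blast+
  have "\<exists>\<^sub>S D. \<forall>d. d \<epsilon> D \<longleftrightarrow> isset d \<and> (\<exists>i. i \<epsilon> succ n \<and> d = val s i)"
    by (rule set_image) (auto simp: is_nat_isset[OF n] intro!: predicative_intros)
  then obtain D where D: "isset D" "\<And>d. d \<epsilon> D \<longleftrightarrow> isset d \<and> (\<exists>i. i \<epsilon> succ n \<and> d = val s i)" by blast
  have "e \<epsilon> D" using D ns(2) isset_term[OF assms] is_nat_isset[OF n] by (auto simp: mem_succ)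
  moreover have "is_term \<rho> d" if "d \<epsilon> D" for d
    using that D(2)[of d] term_formation_prefix[OF ns(1)] by auto
  moreover have "t \<bullet> k \<epsilon> D" if op: "op_symbol \<rho> f m" and t: "is_seq m t" and e: "OpE f t \<epsilon> D" and k: "k \<epsilon> m" for f m t k
  proof -
    obtain i where i: "i \<epsilon> succ n" "OpE f t = val s i" using D(2)[of "OpE f t"] e by auto
    with entry[OF i(1)] obtain g l u where u: "isset g" "isset u" "is_seq l u" "OpE f t = OpE g u"
      "\<forall>k. k \<epsilon> l \<longrightarrow> (\<exists>j. j \<epsilon> i \<and> val u k = val s j)"
      unfolding term_entry_def using is_var_neq_OpE by metis
    then have "u = t" using isset_op_symbol(1)[OF op] isset_seq[OF t] by simp
    \<comment> \<open>The arity is recovered as the domain of the argument sequence.\<close>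
    moreover from this have "l = m" using u(3) t unfolding is_seq_def by blast
    ultimately obtain j where "j \<epsilon> i" "val t k = val s j" using u(5) k by blast
    then show ?thesis using D(2) seq_app[OF t k] is_nat_mem_trans[OF n _ i(1)] by auto
  qed
  ultimately show ?thesis using D(1) by blast
qed

lemma term_cases:
  assumes "is_term \<rho> e"
  shows "is_var e \<or> (\<exists>f n t. op_symbol \<rho> f n \<and> is_seq n t \<and> e = OpE f t \<and> (\<forall>k. k \<epsilon> n \<longrightarrow> is_term \<rho> (t \<bullet> k)))"
proof -
  obtain n s where ns: "term_formation \<rho> n s" "val s n = e"
    using assms unfolding is_term_iff by blast
  then have "term_entry \<rho> s n"
    unfolding term_formation_def by (simp add: mem_succ is_nat_isset)
  moreover obtain D where "e \<epsilon> D" "\<forall>d. d \<epsilon> D \<longrightarrow> is_term \<rho> d"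
    "\<forall>f n t. op_symbol \<rho> f n \<and> is_seq n t \<and> OpE f t \<epsilon> D \<longrightarrow> (\<forall>k. k \<epsilon> n \<longrightarrow> t \<bullet> k \<epsilon> D)"
    using term_closure[OF assms] by blast
  ultimately show ?thesis unfolding term_entry_def ns(2) by metis
qed

lemma term_induct:
  assumes "is_term \<rho> e" and P: "predicative (\<lambda>e. P (e 0))"
    and var: "\<And>x. is_var x \<Longrightarrow> P x"
    and op: "\<And>f n t. op_symbol \<rho> f n \<Longrightarrow> is_seq n t \<Longrightarrow> (\<And>k. k \<epsilon> n \<Longrightarrow> is_term \<rho> (t \<bullet> k)) \<Longrightarrow>
      (\<And>k. k \<epsilon> n \<Longrightarrow> P (t \<bullet> k)) \<Longrightarrow> P (OpE f t)"
  shows "P e"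
proof (rule ccontr)
  assume "\<not> P e"
  obtain n s where ns: "term_formation \<rho> n s" "val s n = e"
    using assms(1) unfolding is_term_iff by blast
  then have n: "is_nat n" and s: "is_seq (succ n) s" and entry: "\<And>i. i \<epsilon> succ n \<Longrightarrow> term_entry \<rho> s i"
    unfolding term_formation_def by blast+
  \<comment> \<open>The counterexample is minimized over indices rather than over terms: arguments
    sit at smaller indices, and \<open>succ n\<close> is a set.\<close>
  have "predicative (\<lambda>e. \<not> P (val s (e 0)))"
    by (intro predicative_intros predicative_subst1[OF P])
  from set_minimal[OF isset_succ[OF is_nat_isset[OF n]] this, of n] \<open>\<not> P e\<close> ns(2)
  obtain i where i: "i \<epsilon> succ n" "\<not> P (val s i)"
    and min: "\<And>j. j \<epsilon> i \<Longrightarrow> j \<epsilon> succ n \<Longrightarrow> P (val s j)"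
    using is_nat_isset[OF n] by (auto simp: mem_succ)
  then have "\<not> is_var (val s i)" using var by blast
  with entry[OF i(1)] obtain f m t where t: "op_symbol \<rho> f m" "is_seq m t"
    "\<forall>k. k \<epsilon> m \<longrightarrow> (\<exists>j. j \<epsilon> i \<and> val t k = val s j)" "val s i = OpE f t"
    unfolding term_entry_def by blast
  have "is_term \<rho> (t \<bullet> k) \<and> P (t \<bullet> k)" if k: "k \<epsilon> m" for k
  proof -
    obtain j where "j \<epsilon> i" "t \<bullet> k = val s j" using t(3) k seq_app(3)[OF t(2) k] by auto
    then show ?thesis
      using min is_nat_mem_trans[OF n _ i(1)] term_formation_prefix[OF ns(1)] by simp
  qed
  then have "P (OpE f t)" using op[OF t(1,2)] by blast
  with i(2) t(4) show False by simp
qed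

section \<open>Paths and subexpressions of terms\<close>

lemma immediate_sub_OpE:
  assumes "isset f" "isset t" shows "immediate_sub d (OpE f t) \<longleftrightarrow> (\<exists>i. i \<epsilon> dom t \<and> d = t \<bullet> i)"
  unfolding immediate_sub_def using assms by (auto simp: expression_defs)

lemma immediate_sub_var: "is_var e \<Longrightarrow> \<not> immediate_sub d e"
  unfolding immediate_sub_def by (auto simp: expression_defs is_var_def)

lemma immediate_sub_term: "is_term \<rho> e \<Longrightarrow> immediate_sub d e \<Longrightarrow> is_term \<rho> d"
proof -
  assume e: "is_term \<rho> e" and d: "immediate_sub d e"
  then obtain f n t where t: "op_symbol \<rho> f n" "is_seq n t" "e = OpE f t" "\<forall>k. k \<epsilon> n \<longrightarrow> is_term \<rho> (t \<bullet> k)"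
    using term_cases immediate_sub_var by metis
  then show ?thesis
    using d immediate_sub_OpE[OF isset_op_symbol(1)[OF t(1)] isset_seq[OF t(2)]]
    unfolding is_seq_def by auto
qed

lemma path_term:
  assumes e: "is_term \<rho> e" and path: "is_path n s e d" and i: "i \<epsilon> succ n"
  shows "is_term \<rho> (s \<bullet> i)"
proof -
  have n: "is_nat n" and s: "is_seq (succ n) s" and start: "s \<bullet> empty = e"
    and step: "\<And>i. i \<epsilon> n \<Longrightarrow> immediate_sub (s \<bullet> succ i) (s \<bullet> i)"
    using path unfolding is_path_def by blast+
  have "is_nat i" using is_nat_mem[OF is_nat_succ[OF n]] i by blast
  \<comment> \<open>The guard is needed because \<open>is_nat_induct\<close> steps through all
    natural numbers, while the path ends at \<open>n\<close>.\<close>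
  then have "i \<epsilon> succ n \<longrightarrow> is_term \<rho> (val s i)"
  proof (rule is_nat_induct)
    show "predicative (\<lambda>e. e 0 \<epsilon> succ n \<longrightarrow> is_term \<rho> (val s (e 0)))" by (intro predicative_intros)
    show "empty \<epsilon> succ n \<longrightarrow> is_term \<rho> (val s empty)"
      using e start seq_app(3)[OF s] by auto
    show "succ k \<epsilon> succ n \<longrightarrow> is_term \<rho> (val s (succ k))"
      if "is_nat k" and IH: "k \<epsilon> succ n \<longrightarrow> is_term \<rho> (val s k)" for k
    proof
      assume k: "succ k \<epsilon> succ n"
      then have "k \<epsilon> n" using mem_of_succ_mem_succ[OF n] that(1) is_nat_isset by blast
      moreover from this have "k \<epsilon> succ n" using n by (simp add: mem_succ is_nat_isset)
      ultimately show "is_term \<rho> (val s (succ k))"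
        using immediate_sub_term[OF _ step] IH seq_app(3)[OF s] k by metis
    qed
  qed
  with i seq_app(3)[OF s i] show ?thesis by simp
qed

lemma subexpression_term: "is_term \<rho> e \<Longrightarrow> subexpression d e \<Longrightarrow> is_term \<rho> d"
proof -
  assume e: "is_term \<rho> e" and "subexpression d e"
  then obtain n s where "is_path n s e d" unfolding subexpression_def by blast
  then show ?thesis
    using path_term[OF e, of n s d n] unfolding is_path_def by (auto simp: mem_succ is_nat_isset)
qed

lemma subexpression_refl:
  assumes "isset e" shows "subexpression e e"
proof -
  have "\<exists>s. is_seq (succ empty) s \<and> (\<forall>i. i \<epsilon> succ empty \<longrightarrow> s \<bullet> i = e)"
    by (rule seq_exists) (use assms in \<open>auto intro!: predicative_intros\<close>)
  then obtain s where "is_seq (succ empty) s" "s \<bullet> empty = e" by (auto simp: mem_succ)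
  then have "is_path empty s e e" "isset s" unfolding is_path_def by (auto simp: is_nat_empty isset_seq)
  then show ?thesis unfolding subexpression_def using isset_empty by blast
qed

text \<open>The path to \<open>x\<close> is prolonged at its start: \<open>e\<close> comes first,
  and the old entries are shifted by one.\<close>

lemma subexpression_immediate:
  assumes "isset e" and d: "immediate_sub d e" and "subexpression x d"
  shows "subexpression x e"
proof -
  obtain n s where "is_path n s d x" using assms(3) unfolding subexpression_def by blast
  then have n: "is_nat n" and s: "is_seq (succ n) s" and start: "s \<bullet> empty = d" and stop: "s \<bullet> n = x"
    and step: "\<And>i. i \<epsilon> n \<Longrightarrow> immediate_sub (s \<bullet> succ i) (s \<bullet> i)"
    unfolding is_path_def by blast+
  note sn = is_nat_succ[OF n]
  \<comment> \<open>The two cases exclude each other because a successor is not empty, and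
    \<open>succ\<close> is injective; this gives the uniqueness that \<open>seq_exists\<close> asks
    for.\<close>
  have "\<exists>r. is_seq (succ (succ n)) r \<and> (\<forall>i. i \<epsilon> succ (succ n) \<longrightarrow>
     (i = empty \<and> r \<bullet> i = e) \<or> (\<exists>\<^sub>S j. i = succ j \<and> r \<bullet> i = val s j))"
  proof (rule seq_exists)
    show "\<exists>\<^sub>S y. i = empty \<and> y = e \<or> (\<exists>\<^sub>S j. i = succ j \<and> y = val s j)"
      if i: "i \<epsilon> succ (succ n)" for i
    proof -
      have "is_nat i" using i is_nat_mem is_nat_succ[OF sn] by blast
      then consider "i = empty" | j where "is_nat j" "i = succ j" using is_nat_cases by blast
      then show ?thesis
      proof cases
        case (2 j)
        then have "j \<epsilon> succ n" using mem_of_succ_mem_succ[OF sn] i is_nat_isset by blast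
        then have "isset (val s j)" using seq_app[OF s] by simp
        with 2 is_nat_isset show ?thesis by blast
      qed (use assms(1) in auto)
    qed
  qed (use n in \<open>auto simp: is_nat_isset dest: succ_inj succ_neq_empty intro!: predicative_intros\<close>)
  then obtain r where r: "is_seq (succ (succ n)) r" "\<And>i. i \<epsilon> succ (succ n) \<Longrightarrow>
     (i = empty \<and> r \<bullet> i = e) \<or> (\<exists>\<^sub>S j. i = succ j \<and> r \<bullet> i = val s j)" by blast
  have r0: "r \<bullet> empty = e" using r(2)[OF empty_mem_succ[OF sn]] succ_neq_empty by metis
  have rs: "r \<bullet> succ j = s \<bullet> j" if "j \<epsilon> succ n" for j
    using r(2)[OF succ_mem_succ[OF sn that]] seq_app(3)[OF s that] succ_inj succ_neq_empty
      isset_mem[OF that] by metis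
  have "is_path (succ n) r e x"
    unfolding is_path_def
  proof (intro conjI allI impI)
    show "r \<bullet> succ n = x" using rs[of n] stop n by (simp add: mem_succ is_nat_isset)
    show "immediate_sub (r \<bullet> succ i) (r \<bullet> i)" if i: "i \<epsilon> succ n" for i
    proof -
      have "is_nat i" using i is_nat_mem sn by blast
      then consider "i = empty" | j where "is_nat j" "i = succ j" using is_nat_cases by blast
      then show ?thesis
      proof cases
        case 1
        then show ?thesis using rs[OF i] r0 start d by simp
      next
        case (2 j)
        then have "j \<epsilon> n" using mem_of_succ_mem_succ[OF n] i is_nat_isset by blast
        moreover from this have "j \<epsilon> succ n" using n by (simp add: mem_succ is_nat_isset)
        ultimately show ?thesis using rs[OF i] rs[of j] step 2 by simp
      qed
    qed
  qed (use sn r0 r(1) in auto)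
  then show ?thesis
    unfolding subexpression_def using sn is_nat_isset isset_seq[OF r(1)] by blast
qed

text \<open>On terms, a predicative form of \<open>subexpression\<close>.\<close>

definition subterm :: "'a \<Rightarrow> 'a \<Rightarrow> bool" where
  "subterm d e \<longleftrightarrow> (\<exists>\<^sub>S n s. is_nat n \<and> is_seq (succ n) s \<and> val s empty = e \<and> val s n = d \<and>
     (\<forall>i. i \<epsilon> n \<longrightarrow> (\<exists>\<^sub>S f t k. val s i = OpE f t \<and> is_function t \<and> k \<epsilon> dom t \<and>
        val s (succ i) = val t k)))"

lemma predicative_subterm [predicative_intros]:
  "definable t \<Longrightarrow> definable u \<Longrightarrow> predicative (\<lambda>e. subterm (t e) (u e))"
  by (rule predicative_subst2[of subterm]) (unfold subterm_def, intro predicative_intros)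

text \<open>By \<open>path_term\<close> every entry of a path starting at a term is a term, so each
  step can only go to an argument of some \<open>OpE\<close>.\<close>

lemma subexpression_iff_subterm:
  assumes e: "is_term \<rho> e" shows "subexpression d e \<longleftrightarrow> subterm d e"
proof -
  have "is_path n s e d \<longleftrightarrow> is_nat n \<and> is_seq (succ n) s \<and> val s empty = e \<and> val s n = d \<and>
     (\<forall>i. i \<epsilon> n \<longrightarrow> (\<exists>\<^sub>S f t k. val s i = OpE f t \<and> is_function t \<and> k \<epsilon> dom t \<and>
        val s (succ i) = val t k))" (is "_ \<longleftrightarrow> ?R") for n s
  proof (cases "is_nat n \<and> is_seq (succ n) s")
    case True
    then have n: "is_nat n" and s: "is_seq (succ n) s" by auto
    have mem: "n \<epsilon> succ n" "empty \<epsilon> succ n" "i \<epsilon> n \<Longrightarrow> i \<epsilon> succ n" "i \<epsilon> n \<Longrightarrow> succ i \<epsilon> succ n" for i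
      using n empty_mem_succ succ_mem_succ by (simp_all add: mem_succ is_nat_isset)
    note eq = mem[THEN seq_app(3)[OF s]]
    show ?thesis
    proof
      assume path: "is_path n s e d"
      have "\<exists>\<^sub>S f t k. val s i = OpE f t \<and> is_function t \<and> k \<epsilon> dom t \<and> val s (succ i) = val t k"
        if i: "i \<epsilon> n" for i
      proof -
        have sub: "immediate_sub (s \<bullet> succ i) (s \<bullet> i)" using path i unfolding is_path_def by blast
        have "is_term \<rho> (s \<bullet> i)" using path_term[OF e path] mem(3) i by blast
        then obtain f m t where t: "op_symbol \<rho> f m" "is_seq m t" "s \<bullet> i = OpE f t"
          using term_cases sub immediate_sub_var by metis
        note set = isset_op_symbol(1)[OF t(1)] isset_seq[OF t(2)]
        obtain k where "k \<epsilon> dom t" "s \<bullet> succ i = t \<bullet> k"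
          using sub immediate_sub_OpE[OF set] t(3) by auto
        moreover have "is_function t" "isset k"
          using t(2) \<open>k \<epsilon> dom t\<close> isset_mem unfolding is_seq_def by auto
        ultimately show ?thesis using set t(3) eq(3,4)[OF i] app_eq_val by metis
      qed
      with path eq show ?R unfolding is_path_def by simp
    next
      assume R: ?R
      have "immediate_sub (s \<bullet> succ i) (s \<bullet> i)" if i: "i \<epsilon> n" for i
      proof -
        obtain f t k where t: "isset f" "isset t" "val s i = OpE f t" "is_function t" "k \<epsilon> dom t"
          "val s (succ i) = val t k" using R i by blast
        then have "immediate_sub (t \<bullet> k) (OpE f t)" using immediate_sub_OpE by blast
        then show ?thesis using t eq(3,4)[OF i] app_eq_val by simp
      qed
      with R eq show "is_path n s e d" unfolding is_path_def by simp
    qed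
  qed (auto simp: is_path_def)
  then show ?thesis unfolding subexpression_def subterm_def by simp
qed

lemma mem_Terms: "e \<epsilon> Terms \<rho> \<longleftrightarrow> is_term \<rho> e"
  unfolding Terms_def by (subst mem_class_of) (auto intro!: predicative_intros dest: isset_term)

lemma mem_Sub_Terms: "e \<epsilon> Sub (Terms \<rho>) \<longleftrightarrow> is_term \<rho> e"
proof -
  have "(\<exists>e. e \<epsilon> Terms \<rho> \<and> subexpression d e) \<longleftrightarrow> is_term \<rho> d" for d
    unfolding mem_Terms using subexpression_term subexpression_refl isset_term by blast
  \<comment> \<open>Both sides are \<open>class_of\<close> of the same predicate, so the
    comprehension instance for \<open>is_term\<close> serves for both.\<close>
  then have "Sub (Terms \<rho>) = Terms \<rho>" unfolding Sub_def by (simp add: Terms_def)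
  then show ?thesis by (simp add: mem_Terms)
qed

lemma term_neq_quantified: "is_term \<rho> e \<Longrightarrow> e \<noteq> AllE x a \<and> e \<noteq> ExE x a"
  using term_cases[of \<rho> e] by (auto simp: is_var_def expression_defs)

text \<open>No entry of a path through a term is quantified, so every occurrence is free. Rewriting
  with \<open>subterm\<close> makes the class \<open>Free e\<close> an instance of
  comprehension.\<close>

lemma mem_Free:
  assumes e: "is_term \<rho> e" shows "x \<epsilon> Free e \<longleftrightarrow> is_var x \<and> subexpression x e"
proof -
  have "(is_var x \<and> (\<exists>\<^sub>S n s. is_path n s e x \<and>
     (\<forall>i. i \<epsilon> succ n \<longrightarrow> \<not> (\<exists>\<^sub>S a. s \<bullet> i = AllE x a \<or> s \<bullet> i = ExE x a)))) \<longleftrightarrow>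
    is_var x \<and> subterm x e" for x
    unfolding subexpression_iff_subterm[OF e, symmetric] subexpression_def
    using term_neq_quantified[OF path_term[OF e]] by blast
  then have "Free e = (CLASS x. is_var x \<and> subterm x e)" unfolding Free_def by simp
  moreover have "x \<epsilon> (CLASS x. is_var x \<and> subterm x e) \<longleftrightarrow> isset x \<and> is_var x \<and> subterm x e"
    by (rule mem_class_of) (intro predicative_intros)
  ultimately show ?thesis using isset_var by (auto simp: subexpression_iff_subterm[OF e])
qed

subsection \<open>Values of terms\<close>

text \<open>The two conditions are bundled because \<open>is_assignment\<close> mentions
  \<open>Free e\<close>, which is brought into predicative form by way of \<open>e\<close> being a
  term.\<close>

definition term_assignment :: "'a \<Rightarrow> 'a \<Rightarrow> 'a \<Rightarrow> 'a \<Rightarrow> bool" where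
  "term_assignment \<rho> \<SS> e A \<longleftrightarrow> is_term \<rho> e \<and> is_assignment \<rho> \<SS> e A"

lemma predicative_term_assignment [predicative_intros]:
  "definable t \<Longrightarrow> definable u \<Longrightarrow> predicative (\<lambda>e. term_assignment \<rho> \<SS> (t e) (u e))"
proof (rule predicative_subst2[of "term_assignment \<rho> \<SS>"])
  have "term_assignment \<rho> \<SS> e A \<longleftrightarrow> is_term \<rho> e \<and> is_finite A \<and> is_function A \<and>
      (\<forall>x. x \<epsilon> dom A \<longrightarrow> val A x \<epsilon> universe \<rho> \<SS>) \<and>
      (\<forall>\<^sub>S x. is_var x \<and> subterm x e \<longrightarrow> x \<epsilon> dom A)" for e A
  proof (cases "is_term \<rho> e \<and> is_function A")
    case True
    then have "Free e \<sqsubseteq> dom A \<longleftrightarrow> (\<forall>\<^sub>S x. is_var x \<and> subterm x e \<longrightarrow> x \<epsilon> dom A)"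
      unfolding included_def using mem_Free[of \<rho> e] subexpression_iff_subterm[of \<rho> e] isset_var by auto
    with True show ?thesis
      unfolding term_assignment_def is_assignment_def using app_eq_val[of A] by auto
  qed (auto simp: term_assignment_def is_assignment_def)
  then show "predicative (\<lambda>e. term_assignment \<rho> \<SS> (e 0) (e (Suc 0)))"
    by (rule predicative_cong) (intro predicative_intros)
qed

lemma term_assignment_isset: "term_assignment \<rho> \<SS> e A \<Longrightarrow> isset e" "term_assignment \<rho> \<SS> e A \<Longrightarrow> isset A"
  unfolding term_assignment_def is_assignment_def is_finite_def using isset_term by blast+

text \<open>With this an assignment for a compound term is one for its arguments, so the recursion
  can keep \<open>A\<close> fixed.\<close>

lemma Free_arg:
  assumes "is_term \<rho> (OpE f t)" "isset f" "isset t" "k \<epsilon> dom t"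
  shows "Free (t \<bullet> k) \<sqsubseteq> Free (OpE f t)"
proof -
  have sub: "immediate_sub (t \<bullet> k) (OpE f t)"
    using immediate_sub_OpE assms(2-4) by blast
  then have "is_term \<rho> (t \<bullet> k)" using immediate_sub_term assms(1) by blast
  then show ?thesis
    unfolding included_def
    using assms(1) subexpression_immediate[OF isset_term[OF assms(1)] sub] by (simp add: mem_Free)
qed

lemma op_term_cases:
  assumes "is_term \<rho> (OpE f t)" "isset f" "isset t"
  obtains n where "op_symbol \<rho> f n" "is_seq n t" "dom t = n" "\<And>k. k \<epsilon> n \<Longrightarrow> is_term \<rho> (t \<bullet> k)"
proof -
  obtain g n u where u: "op_symbol \<rho> g n" "is_seq n u" "OpE f t = OpE g u" "\<forall>k. k \<epsilon> n \<longrightarrow> is_term \<rho> (u \<bullet> k)"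
    using term_cases[OF assms(1)] is_var_neq_OpE by metis
  then have "g = f" "u = t" using assms(2,3) isset_op_symbol isset_seq by auto
  with u that[of n] show thesis unfolding is_seq_def by auto
qed

lemma term_assignment_arg:
  assumes "term_assignment \<rho> \<SS> (OpE f t) A" "isset f" "isset t" "k \<epsilon> dom t"
  shows "term_assignment \<rho> \<SS> (t \<bullet> k) A"
proof -
  have "is_term \<rho> (t \<bullet> k)"
    using op_term_cases[of \<rho> f t] assms unfolding term_assignment_def by metis
  then show ?thesis
    using assms Free_arg[of \<rho> f t k]
    unfolding term_assignment_def is_assignment_def included_def by blast
qed

text \<open>
  A valuation is a proper class when there are infinitely many terms, so it cannot be quantified
  over in a comprehension. It is glued from sets \<open>g\<close> of pairs of a term and its value that contain
  with every compound term all its arguments.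
\<close>

definition partial_valuation :: "'a \<Rightarrow> 'a \<Rightarrow> 'a \<Rightarrow> 'a \<Rightarrow> bool" where
  "partial_valuation \<rho> \<SS> A g \<longleftrightarrow> (\<forall>\<^sub>S e v. \<langle>e, v\<rangle> \<epsilon> g \<longrightarrow> (is_var e \<and> \<langle>e, v\<rangle> \<epsilon> A) \<or>
     (\<exists>\<^sub>S f n t w. op_symbol \<rho> f n \<and> is_seq n t \<and> is_seq n w \<and> e = OpE f t \<and>
        \<langle>f, \<langle>w, v\<rangle>\<rangle> \<epsilon> \<SS> \<and> (\<forall>k. k \<epsilon> n \<longrightarrow> \<langle>val t k, val w k\<rangle> \<epsilon> g)))"

definition has_value :: "'a \<Rightarrow> 'a \<Rightarrow> 'a \<Rightarrow> 'a \<Rightarrow> 'a \<Rightarrow> bool" where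
  "has_value \<rho> \<SS> A e v \<longleftrightarrow> (\<exists>\<^sub>S g. partial_valuation \<rho> \<SS> A g \<and> \<langle>e, v\<rangle> \<epsilon> g)"

lemma predicative_has_value [predicative_intros]:
  "definable t \<Longrightarrow> definable u \<Longrightarrow> definable v \<Longrightarrow> predicative (\<lambda>e. has_value \<rho> \<SS> (t e) (u e) (v e))"
  by (rule predicative_subst3[of "has_value \<rho> \<SS>"])
    (unfold has_value_def partial_valuation_def, intro predicative_intros)

lemma partial_valuation_cases:
  assumes "partial_valuation \<rho> \<SS> A g" "\<langle>e, v\<rangle> \<epsilon> g" "isset e" "isset v"
  obtains (var) "is_var e" "\<langle>e, v\<rangle> \<epsilon> A"
  | (op) f n t w where "op_symbol \<rho> f n" "is_seq n t" "is_seq n w" "e = OpE f t"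
      "\<langle>f, \<langle>w, v\<rangle>\<rangle> \<epsilon> \<SS>" "\<And>k. k \<epsilon> n \<Longrightarrow> \<langle>t \<bullet> k, w \<bullet> k\<rangle> \<epsilon> g"
proof -
  have "(is_var e \<and> \<langle>e, v\<rangle> \<epsilon> A) \<or>
     (\<exists>\<^sub>S f n t w. op_symbol \<rho> f n \<and> is_seq n t \<and> is_seq n w \<and> e = OpE f t \<and>
        \<langle>f, \<langle>w, v\<rangle>\<rangle> \<epsilon> \<SS> \<and> (\<forall>k. k \<epsilon> n \<longrightarrow> \<langle>val t k, val w k\<rangle> \<epsilon> g))"
    using assms unfolding partial_valuation_def by blast
  then show thesis
  proof
    assume "\<exists>\<^sub>S f n t w. op_symbol \<rho> f n \<and> is_seq n t \<and> is_seq n w \<and> e = OpE f t \<and>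
        \<langle>f, \<langle>w, v\<rangle>\<rangle> \<epsilon> \<SS> \<and> (\<forall>k. k \<epsilon> n \<longrightarrow> \<langle>val t k, val w k\<rangle> \<epsilon> g)"
    then obtain f n t w where tw: "op_symbol \<rho> f n" "is_seq n t" "is_seq n w" "e = OpE f t"
        "\<langle>f, \<langle>w, v\<rangle>\<rangle> \<epsilon> \<SS>" "\<forall>k. k \<epsilon> n \<longrightarrow> \<langle>val t k, val w k\<rangle> \<epsilon> g" by blast
    show thesis
      by (rule op[OF tw(1-5)]) (use tw(6) seq_app(3)[OF tw(2)] seq_app(3)[OF tw(3)] in simp)
  qed (use var in blast)
qed

lemma partial_valuationI:
  assumes "\<And>e v. isset e \<Longrightarrow> isset v \<Longrightarrow> \<langle>e, v\<rangle> \<epsilon> g \<Longrightarrow> (is_var e \<and> \<langle>e, v\<rangle> \<epsilon> A) \<or>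
     (\<exists>f n t w. op_symbol \<rho> f n \<and> is_seq n t \<and> is_seq n w \<and> e = OpE f t \<and>
        \<langle>f, \<langle>w, v\<rangle>\<rangle> \<epsilon> \<SS> \<and> (\<forall>k. k \<epsilon> n \<longrightarrow> \<langle>t \<bullet> k, w \<bullet> k\<rangle> \<epsilon> g))"
  shows "partial_valuation \<rho> \<SS> A g"
  unfolding partial_valuation_def
proof (intro allI impI)
  fix e v assume set: "isset e" "isset v" and "\<langle>e, v\<rangle> \<epsilon> g"
  from assms[OF this]
  show "(is_var e \<and> \<langle>e, v\<rangle> \<epsilon> A) \<or>
     (\<exists>\<^sub>S f n t w. op_symbol \<rho> f n \<and> is_seq n t \<and> is_seq n w \<and> e = OpE f t \<and>
        \<langle>f, \<langle>w, v\<rangle>\<rangle> \<epsilon> \<SS> \<and> (\<forall>k. k \<epsilon> n \<longrightarrow> \<langle>val t k, val w k\<rangle> \<epsilon> g))"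
  proof
    assume "\<exists>f n t w. op_symbol \<rho> f n \<and> is_seq n t \<and> is_seq n w \<and> e = OpE f t \<and>
        \<langle>f, \<langle>w, v\<rangle>\<rangle> \<epsilon> \<SS> \<and> (\<forall>k. k \<epsilon> n \<longrightarrow> \<langle>t \<bullet> k, w \<bullet> k\<rangle> \<epsilon> g)"
    then obtain f n t w where tw: "op_symbol \<rho> f n" "is_seq n t" "is_seq n w" "e = OpE f t"
        "\<langle>f, \<langle>w, v\<rangle>\<rangle> \<epsilon> \<SS>" "\<forall>k. k \<epsilon> n \<longrightarrow> \<langle>t \<bullet> k, w \<bullet> k\<rangle> \<epsilon> g" by blast
    moreover have "\<langle>val t k, val w k\<rangle> \<epsilon> g" if "k \<epsilon> n" for k
      using tw(6)[rule_format, OF that] seq_app(3)[OF tw(2) that] seq_app(3)[OF tw(3) that] by simp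
    ultimately show ?thesis
      using isset_op_symbol[OF tw(1)] isset_seq[OF tw(2)] isset_seq[OF tw(3)] by blast
  qed blast
qed

text \<open>A witness for a compound term is closed under arguments, so the same \<open>g\<close>
  witnesses the values of all of them.\<close>

lemma has_value_cases:
  assumes "has_value \<rho> \<SS> A e v" "isset e" "isset v"
  obtains (var) "is_var e" "\<langle>e, v\<rangle> \<epsilon> A"
  | (op) f n t w where "op_symbol \<rho> f n" "is_seq n t" "is_seq n w" "e = OpE f t"
      "\<langle>f, \<langle>w, v\<rangle>\<rangle> \<epsilon> \<SS>" "\<And>k. k \<epsilon> n \<Longrightarrow> has_value \<rho> \<SS> A (t \<bullet> k) (w \<bullet> k)"
proof -
  obtain g where g: "isset g" "partial_valuation \<rho> \<SS> A g" "\<langle>e, v\<rangle> \<epsilon> g"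
    using assms(1) unfolding has_value_def by blast
  from g(2,3) assms(2,3) show thesis
  proof (cases rule: partial_valuation_cases)
    case (op f n t w)
    with that(2) g(1,2) show thesis unfolding has_value_def by blast
  qed (use that in blast)
qed

lemma has_value_var:
  assumes "is_var e" "\<langle>e, v\<rangle> \<epsilon> A" "isset v" shows "has_value \<rho> \<SS> A e v"
proof -
  note e = isset_var[OF assms(1)]
  obtain g where g: "isset g" "\<And>p. p \<epsilon> g \<longleftrightarrow> p \<epsilon> empty \<or> p = \<langle>e, v\<rangle>"
    using set_insert[OF isset_empty isset_opair[OF e assms(3)]] by blast
  have "partial_valuation \<rho> \<SS> A g"
    by (rule partial_valuationI) (use g(2) assms e in auto)
  then show ?thesis unfolding has_value_def using g by auto
qed

section \<open>Valuation functions on terms and their uniqueness\<close>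

lemma tarski_clauses_var: "is_var e \<Longrightarrow> tarski_clauses \<rho> \<SS> F e A \<longleftrightarrow> F \<bullet> \<langle>e, A\<rangle> = A \<bullet> e"
  unfolding tarski_clauses_def by (auto simp: is_var_def expression_defs)

lemma tarski_clauses_OpE:
  "isset f \<Longrightarrow> isset t \<Longrightarrow> tarski_clauses \<rho> \<SS> F (OpE f t) A \<longleftrightarrow>
     (\<exists>v. values_of F A t v \<and> F \<bullet> \<langle>OpE f t, A\<rangle> = interp \<SS> f \<bullet> v)"
  unfolding tarski_clauses_def by (auto simp: is_var_def expression_defs)

text \<open>Formula tags are 2 to 11, term tags 0 and 1. This discharges the clause on formula
  values in \<open>is_valuation_function\<close>.\<close>

lemma term_not_formula: "is_term \<rho> e \<Longrightarrow> \<not> is_formula \<rho> e"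
proof
  assume e: "is_term \<rho> e" and "is_formula \<rho> e"
  then obtain n s where "is_nat n" "s \<bullet> n = e"
    "\<forall>i. i \<epsilon> succ n \<longrightarrow> formula_step \<rho> (\<lambda>d. \<exists>j. j \<epsilon> i \<and> d = s \<bullet> j) (s \<bullet> i)"
    unfolding is_formula_def formed_def by blast
  then obtain Prev where "formula_step \<rho> Prev e" by (metis mem_succ is_nat_isset)
  with term_cases[OF e] show False
    unfolding formula_step_def by (auto simp: is_var_def expression_defs)
qed

lemma mem_valuation_dom:
  "p \<epsilon> (CLASS p. \<exists>\<^sub>S e A. p = \<langle>e, A\<rangle> \<and> e \<epsilon> Sub (Terms \<rho>) \<and> is_assignment \<rho> \<SS> e A) \<longleftrightarrow>
    (\<exists>e A. p = \<langle>e, A\<rangle> \<and> term_assignment \<rho> \<SS> e A)"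
proof -
  have "p \<epsilon> (CLASS p. \<exists>\<^sub>S e A. p = \<langle>e, A\<rangle> \<and> term_assignment \<rho> \<SS> e A) \<longleftrightarrow>
      isset p \<and> (\<exists>\<^sub>S e A. p = \<langle>e, A\<rangle> \<and> term_assignment \<rho> \<SS> e A)"
    by (rule mem_class_of) (intro predicative_intros)
  moreover have "(\<exists>e A. p = \<langle>e, A\<rangle> \<and> term_assignment \<rho> \<SS> e A) \<longleftrightarrow>
      isset p \<and> (\<exists>\<^sub>S e A. p = \<langle>e, A\<rangle> \<and> term_assignment \<rho> \<SS> e A)"
    using term_assignment_isset[of \<rho> \<SS>] isset_opair by metis
  ultimately show ?thesis by (simp add: mem_Sub_Terms term_assignment_def)
qed

lemma valuation_function_iff:
  "is_valuation_function \<rho> \<SS> (Terms \<rho>) F \<longleftrightarrow> is_function F \<and>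
    (\<forall>p. p \<epsilon> dom F \<longleftrightarrow> (\<exists>e A. p = \<langle>e, A\<rangle> \<and> term_assignment \<rho> \<SS> e A)) \<and>
    (\<forall>e A. term_assignment \<rho> \<SS> e A \<longrightarrow>
      F \<bullet> \<langle>e, A\<rangle> \<epsilon> universe \<rho> \<SS> \<and> tarski_clauses \<rho> \<SS> F e A)"
proof -
  have "dom F = (CLASS p. \<exists>\<^sub>S e A. p = \<langle>e, A\<rangle> \<and> e \<epsilon> Sub (Terms \<rho>) \<and> is_assignment \<rho> \<SS> e A) \<longleftrightarrow>
    (\<forall>p. p \<epsilon> dom F \<longleftrightarrow> (\<exists>e A. p = \<langle>e, A\<rangle> \<and> term_assignment \<rho> \<SS> e A))"
    unfolding mem_valuation_dom[symmetric] by (auto intro: extensionality)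
  moreover have "(e \<epsilon> Sub (Terms \<rho>) \<and> is_assignment \<rho> \<SS> e A \<longrightarrow>
        (is_term \<rho> e \<longrightarrow> F \<bullet> \<langle>e, A\<rangle> \<epsilon> universe \<rho> \<SS>) \<and>
        (is_formula \<rho> e \<longrightarrow> F \<bullet> \<langle>e, A\<rangle> = num 0 \<or> F \<bullet> \<langle>e, A\<rangle> = num 1) \<and>
        tarski_clauses \<rho> \<SS> F e A) \<longleftrightarrow>
      (term_assignment \<rho> \<SS> e A \<longrightarrow> F \<bullet> \<langle>e, A\<rangle> \<epsilon> universe \<rho> \<SS> \<and> tarski_clauses \<rho> \<SS> F e A)" for e A
    unfolding mem_Sub_Terms term_assignment_def using term_not_formula[of \<rho> e] by blast
  ultimately show ?thesis
    unfolding is_valuation_function_def by (simp only:)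
qed

lemma valuation_function_unique:
  assumes F: "is_valuation_function \<rho> \<SS> (Terms \<rho>) F" and G: "is_valuation_function \<rho> \<SS> (Terms \<rho>) G"
  shows "F = G"
proof (rule is_function_eqI)
  show func: "is_function F" "is_function G" using F G unfolding valuation_function_iff by blast+
  have dom: "p \<epsilon> dom F \<longleftrightarrow> (\<exists>e A. p = \<langle>e, A\<rangle> \<and> term_assignment \<rho> \<SS> e A)"
    "p \<epsilon> dom G \<longleftrightarrow> (\<exists>e A. p = \<langle>e, A\<rangle> \<and> term_assignment \<rho> \<SS> e A)" for p
    using F G unfolding valuation_function_iff by blast+
  show "dom F = dom G" by (rule extensionality) (simp add: dom)
  fix p assume "p \<epsilon> dom F"
  then obtain e A where p: "p = \<langle>e, A\<rangle>" and eA: "term_assignment \<rho> \<SS> e A" using dom by blast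
  have A: "isset A" and e: "is_term \<rho> e"
    using eA term_assignment_isset unfolding term_assignment_def by blast+
  have clauses: "tarski_clauses \<rho> \<SS> F e A" "tarski_clauses \<rho> \<SS> G e A"
    if "term_assignment \<rho> \<SS> e A" for e
    using F G that unfolding valuation_function_iff by blast+
  have pairs: "\<langle>\<langle>e, A\<rangle>, F \<bullet> \<langle>e, A\<rangle>\<rangle> \<epsilon> F" "\<langle>\<langle>e, A\<rangle>, G \<bullet> \<langle>e, A\<rangle>\<rangle> \<epsilon> G"
    "isset (F \<bullet> \<langle>e, A\<rangle>)" "isset (G \<bullet> \<langle>e, A\<rangle>)" if "term_assignment \<rho> \<SS> e A" for e
    using app_pair[OF func(1), of "\<langle>e, A\<rangle>"] app_pair[OF func(2), of "\<langle>e, A\<rangle>"] that dom by blast+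
  \<comment> \<open>Agreement of \<open>F\<close> and \<open>G\<close> is stated through a common
    value \<open>u\<close>, because an equation between \<open>app\<close> terms is not evidently
    predicative. The assignment stays fixed, as no term clause changes it.\<close>
  have "term_assignment \<rho> \<SS> e A \<longrightarrow> (\<exists>\<^sub>S u. \<langle>\<langle>e, A\<rangle>, u\<rangle> \<epsilon> F \<and> \<langle>\<langle>e, A\<rangle>, u\<rangle> \<epsilon> G)"
  proof (rule term_induct[OF e])
    show "predicative (\<lambda>e. term_assignment \<rho> \<SS> (e 0) A \<longrightarrow>
        (\<exists>\<^sub>S u. \<langle>\<langle>e 0, A\<rangle>, u\<rangle> \<epsilon> F \<and> \<langle>\<langle>e 0, A\<rangle>, u\<rangle> \<epsilon> G))"
      by (intro predicative_intros)
    show "term_assignment \<rho> \<SS> x A \<longrightarrow> (\<exists>\<^sub>S u. \<langle>\<langle>x, A\<rangle>, u\<rangle> \<epsilon> F \<and> \<langle>\<langle>x, A\<rangle>, u\<rangle> \<epsilon> G)"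
      if "is_var x" for x
      using clauses pairs tarski_clauses_var[OF that] by metis
  next
    fix f n t
    assume f: "op_symbol \<rho> f n" and t: "is_seq n t"
      and IH: "\<And>k. k \<epsilon> n \<Longrightarrow> term_assignment \<rho> \<SS> (t \<bullet> k) A \<longrightarrow>
        (\<exists>\<^sub>S u. \<langle>\<langle>t \<bullet> k, A\<rangle>, u\<rangle> \<epsilon> F \<and> \<langle>\<langle>t \<bullet> k, A\<rangle>, u\<rangle> \<epsilon> G)"
    note set = isset_op_symbol(1)[OF f] isset_seq[OF t]
    have n: "dom t = n" using t unfolding is_seq_def by blast
    have "F \<bullet> \<langle>OpE f t, A\<rangle> = G \<bullet> \<langle>OpE f t, A\<rangle>" if eA: "term_assignment \<rho> \<SS> (OpE f t) A"
    proof -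
      obtain v where v: "values_of F A t v" "F \<bullet> \<langle>OpE f t, A\<rangle> = interp \<SS> f \<bullet> v"
        using clauses(1)[OF eA] tarski_clauses_OpE[OF set] by blast
      obtain w where w: "values_of G A t w" "G \<bullet> \<langle>OpE f t, A\<rangle> = interp \<SS> f \<bullet> w"
        using clauses(2)[OF eA] tarski_clauses_OpE[OF set] by blast
      have "F \<bullet> \<langle>t \<bullet> k, A\<rangle> = G \<bullet> \<langle>t \<bullet> k, A\<rangle>" if k: "k \<epsilon> n" for k
      proof -
        have "term_assignment \<rho> \<SS> (t \<bullet> k) A" using term_assignment_arg[OF eA set] k n by simp
        then obtain u where "isset u" "\<langle>\<langle>t \<bullet> k, A\<rangle>, u\<rangle> \<epsilon> F" "\<langle>\<langle>t \<bullet> k, A\<rangle>, u\<rangle> \<epsilon> G" using IH[OF k] by blast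
        then show ?thesis using app_eq func isset_opair[OF seq_app(2)[OF t k] A] by metis
      qed
      then have "v = w"
        using v(1) w(1) n unfolding values_of_def by - (rule seq_eqI[of n], simp_all)
      with v(2) w(2) show ?thesis by simp
    qed
    then show "term_assignment \<rho> \<SS> (OpE f t) A \<longrightarrow>
        (\<exists>\<^sub>S u. \<langle>\<langle>OpE f t, A\<rangle>, u\<rangle> \<epsilon> F \<and> \<langle>\<langle>OpE f t, A\<rangle>, u\<rangle> \<epsilon> G)"
      using pairs by metis
  qed
  then obtain u where "isset u" "\<langle>p, u\<rangle> \<epsilon> F" "\<langle>p, u\<rangle> \<epsilon> G" using eA p by blast
  moreover have "isset p" using \<open>p \<epsilon> dom F\<close> by (rule isset_mem)
  ultimately show "F \<bullet> p = G \<bullet> p" using app_eq func by metis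
qed

end

section \<open>Values in a fixed structure, and existence of the valuation\<close>

locale class_structure = class_theory_C +
  fixes \<rho> \<SS> assumes struct: "is_structure \<rho> \<SS>"
begin

lemma interp_op:
  assumes "op_symbol \<rho> f n"
  shows "is_function (interp \<SS> f)"
    and "w \<epsilon> dom (interp \<SS> f) \<longleftrightarrow> tuple_in (universe \<rho> \<SS>) n w"
    and "w \<epsilon> dom (interp \<SS> f) \<Longrightarrow> interp \<SS> f \<bullet> w \<epsilon> universe \<rho> \<SS>"
  using struct assms unfolding is_structure_def by blast+

lemma interp_app_eq:
  assumes "op_symbol \<rho> f n" "\<langle>f, \<langle>w, v\<rangle>\<rangle> \<epsilon> \<SS>" "isset w" "isset v"
  shows "interp \<SS> f \<bullet> w = v" "v \<epsilon> universe \<rho> \<SS>"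
proof -
  have mem: "\<langle>w, v\<rangle> \<epsilon> interp \<SS> f" using assms by (simp add: mem_interp)
  then show eq: "interp \<SS> f \<bullet> w = v" using app_eq interp_op(1) assms by blast
  have "w \<epsilon> dom (interp \<SS> f)" using mem assms(3,4) mem_dom by blast
  then show "v \<epsilon> universe \<rho> \<SS>" using interp_op(3) assms(1) eq by blast
qed

lemma has_value_unique:
  assumes "is_term \<rho> e" and A: "is_function A"
    and "isset u" "isset v" "has_value \<rho> \<SS> A e u" "has_value \<rho> \<SS> A e v"
  shows "u = v"
proof -
  have "\<forall>\<^sub>S u v. has_value \<rho> \<SS> A e u \<and> has_value \<rho> \<SS> A e v \<longrightarrow> u = v"
  proof (rule term_induct[OF assms(1)])
    show "predicative (\<lambda>e. \<forall>\<^sub>S u v. has_value \<rho> \<SS> A (e 0) u \<and> has_value \<rho> \<SS> A (e 0) v \<longrightarrow> u = v)"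
      by (intro predicative_intros)
  next
    fix x assume x: "is_var x"
    have "A \<bullet> x = u" if "has_value \<rho> \<SS> A x u" "isset u" for u
      using that(1) isset_var[OF x] that(2)
      by (cases rule: has_value_cases) (use app_eq[OF A] isset_var[OF x] that(2) x in auto)
    then show "\<forall>\<^sub>S u v. has_value \<rho> \<SS> A x u \<and> has_value \<rho> \<SS> A x v \<longrightarrow> u = v" by metis
  next
    fix f n t
    assume f: "op_symbol \<rho> f n" and t: "is_seq n t"
      and IH: "\<And>k. k \<epsilon> n \<Longrightarrow> \<forall>\<^sub>S u v. has_value \<rho> \<SS> A (t \<bullet> k) u \<and> has_value \<rho> \<SS> A (t \<bullet> k) v \<longrightarrow> u = v"
    note set = isset_op_symbol(1)[OF f] isset_seq[OF t]
    have step: "\<exists>w. is_seq n w \<and> interp \<SS> f \<bullet> w = u \<and> (\<forall>k. k \<epsilon> n \<longrightarrow> has_value \<rho> \<SS> A (t \<bullet> k) (w \<bullet> k))"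
      if u: "has_value \<rho> \<SS> A (OpE f t) u" "isset u" for u
      using u(1) isset_OpE[OF set] u(2)
    proof (cases rule: has_value_cases)
      case (op f' n' t' w)
      then have eq: "f' = f" "t' = t" using set isset_op_symbol(1) isset_seq by auto
      moreover from this have "n' = n" using op t unfolding is_seq_def by blast
      ultimately show ?thesis
        using op interp_app_eq(1)[OF f, of w u] isset_seq u(2) by blast
    qed (use is_var_neq_OpE in blast)
    have "u = v" if u: "has_value \<rho> \<SS> A (OpE f t) u" "isset u" and v: "has_value \<rho> \<SS> A (OpE f t) v" "isset v" for u v
    proof -
      obtain w where w: "is_seq n w" "interp \<SS> f \<bullet> w = u" "\<forall>k. k \<epsilon> n \<longrightarrow> has_value \<rho> \<SS> A (t \<bullet> k) (w \<bullet> k)"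
        using step[OF u] by blast
      obtain w' where w': "is_seq n w'" "interp \<SS> f \<bullet> w' = v" "\<forall>k. k \<epsilon> n \<longrightarrow> has_value \<rho> \<SS> A (t \<bullet> k) (w' \<bullet> k)"
        using step[OF v] by blast
      have "w = w'"
        by (rule seq_eqI[OF w(1) w'(1)]) (use IH w w' seq_app(2)[OF w(1)] seq_app(2)[OF w'(1)] in blast)
      with w w' show ?thesis by simp
    qed
    then show "\<forall>\<^sub>S u v. has_value \<rho> \<SS> A (OpE f t) u \<and> has_value \<rho> \<SS> A (OpE f t) v \<longrightarrow> u = v" by blast
  qed
  with assms(3-) show ?thesis by blast
qed

lemma has_value_universe:
  assumes A: "is_function A" "\<forall>x. x \<epsilon> dom A \<longrightarrow> A \<bullet> x \<epsilon> universe \<rho> \<SS>"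
    and v: "has_value \<rho> \<SS> A e v" "isset e" "isset v"
  shows "v \<epsilon> universe \<rho> \<SS>"
  using v
proof (cases rule: has_value_cases)
  case var
  then have "e \<epsilon> dom A" "A \<bullet> e = v" using v A app_eq mem_dom by blast+
  with A(2) show ?thesis by blast
next
  case (op f n t w)
  then show ?thesis using interp_app_eq(2) isset_seq v(3) by blast
qed

lemma has_value_exists:
  assumes e: "is_term \<rho> e" and A: "is_function A" "\<forall>x. x \<epsilon> dom A \<longrightarrow> A \<bullet> x \<epsilon> universe \<rho> \<SS>"
    and free: "Free e \<sqsubseteq> dom A"
  shows "\<exists>\<^sub>S v. has_value \<rho> \<SS> A e v"
proof -
  obtain D where D: "isset D" "e \<epsilon> D" "\<And>d. d \<epsilon> D \<Longrightarrow> is_term \<rho> d"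
    "\<And>f n t k. op_symbol \<rho> f n \<Longrightarrow> is_seq n t \<Longrightarrow> OpE f t \<epsilon> D \<Longrightarrow> k \<epsilon> n \<Longrightarrow> t \<bullet> k \<epsilon> D"
    using term_closure[OF e] by blast
  have unique: "u = v" if "d \<epsilon> D" "isset u" "isset v" "has_value \<rho> \<SS> A d u" "has_value \<rho> \<SS> A d v" for d u v
    using has_value_unique[OF D(3) A(1)] that by blast
  \<comment> \<open>One \<open>g\<close> for all of \<open>D\<close> replaces a separate witness for
    each argument, among which one would have to choose.\<close>
  have "\<exists>\<^sub>S g. \<forall>p. p \<epsilon> g \<longleftrightarrow> isset p \<and> (\<exists>d. d \<epsilon> D \<and> (\<exists>\<^sub>S v. has_value \<rho> \<SS> A d v \<and> p = \<langle>d, v\<rangle>))"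
  proof (rule set_image[OF D(1)])
    show "predicative (\<lambda>e. \<exists>\<^sub>S v. has_value \<rho> \<SS> A (e 0) v \<and> e (Suc 0) = \<langle>e 0, v\<rangle>)"
      by (intro predicative_intros)
  qed (use unique in blast)
  then obtain g where g: "isset g"
    "\<And>p. p \<epsilon> g \<longleftrightarrow> isset p \<and> (\<exists>d. d \<epsilon> D \<and> (\<exists>\<^sub>S v. has_value \<rho> \<SS> A d v \<and> p = \<langle>d, v\<rangle>))" by blast
  have mem_g: "\<langle>d, v\<rangle> \<epsilon> g \<longleftrightarrow> d \<epsilon> D \<and> has_value \<rho> \<SS> A d v" if "isset d" "isset v" for d v
    unfolding g(2) using that by (metis opair_eq_iff isset_mem isset_opair)
  \<comment> \<open>This says that \<open>g\<close> is itself a partial valuation: closure of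
    \<open>D\<close> keeps the argument pairs inside \<open>g\<close>.\<close>
  have g_cases: "(is_var d \<and> \<langle>d, v\<rangle> \<epsilon> A) \<or>
     (\<exists>f n t w. op_symbol \<rho> f n \<and> is_seq n t \<and> is_seq n w \<and> d = OpE f t \<and>
        \<langle>f, \<langle>w, v\<rangle>\<rangle> \<epsilon> \<SS> \<and> (\<forall>k. k \<epsilon> n \<longrightarrow> \<langle>t \<bullet> k, w \<bullet> k\<rangle> \<epsilon> g))"
    if d: "\<langle>d, v\<rangle> \<epsilon> g" "isset d" "isset v" for d v
  proof -
    have "d \<epsilon> D" and "has_value \<rho> \<SS> A d v" using mem_g[OF d(2,3)] d(1) by auto
    from this(2) d(2,3) show ?thesis
    proof (cases rule: has_value_cases)
      case (op f n t w)
      then have "\<langle>t \<bullet> k, w \<bullet> k\<rangle> \<epsilon> g" if "k \<epsilon> n" for k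
        using that D(4) \<open>d \<epsilon> D\<close> mem_g seq_app(2) by blast
      with op show ?thesis by blast
    qed blast
  qed
  \<comment> \<open>A member of \<open>D\<close> that is no subterm of \<open>e\<close> may have
    variables outside \<open>dom A\<close>, so the condition on variables travels with the
    induction; \<open>subterm\<close> keeps it predicative.\<close>
  have "d \<epsilon> D \<and> (\<forall>\<^sub>S x. is_var x \<and> subterm x d \<longrightarrow> x \<epsilon> dom A) \<longrightarrow> (\<exists>\<^sub>S v. has_value \<rho> \<SS> A d v)"
    if "is_term \<rho> d" for d
  proof (rule term_induct[OF that])
    show "predicative (\<lambda>e. e 0 \<epsilon> D \<and> (\<forall>\<^sub>S x. is_var x \<and> subterm x (e 0) \<longrightarrow> x \<epsilon> dom A) \<longrightarrow>
        (\<exists>\<^sub>S v. has_value \<rho> \<SS> A (e 0) v))"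
      by (intro predicative_intros)
  next
    fix x assume x: "is_var x"
    have "\<exists>\<^sub>S v. has_value \<rho> \<SS> A x v"
      if x': "x \<epsilon> D" "\<forall>\<^sub>S y. is_var y \<and> subterm y x \<longrightarrow> y \<epsilon> dom A"
    proof -
      have "subterm x x"
        using subexpression_refl[OF isset_var[OF x]] subexpression_iff_subterm[OF D(3)[OF x'(1)]] by blast
      then have "x \<epsilon> dom A" using x x'(2) isset_var by blast
      then show ?thesis using has_value_var[OF x] app_pair[OF A(1)] by blast
    qed
    then show "x \<epsilon> D \<and> (\<forall>\<^sub>S y. is_var y \<and> subterm y x \<longrightarrow> y \<epsilon> dom A) \<longrightarrow> (\<exists>\<^sub>S v. has_value \<rho> \<SS> A x v)"
      by blast
  next
    fix f n t
    assume f: "op_symbol \<rho> f n" and t: "is_seq n t" and args: "\<And>k. k \<epsilon> n \<Longrightarrow> is_term \<rho> (t \<bullet> k)"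
      and IH: "\<And>k. k \<epsilon> n \<Longrightarrow> t \<bullet> k \<epsilon> D \<and> (\<forall>\<^sub>S x. is_var x \<and> subterm x (t \<bullet> k) \<longrightarrow> x \<epsilon> dom A) \<longrightarrow>
        (\<exists>\<^sub>S v. has_value \<rho> \<SS> A (t \<bullet> k) v)"
    note set = isset_op_symbol(1)[OF f] isset_seq[OF t]
    have "\<exists>\<^sub>S v. has_value \<rho> \<SS> A (OpE f t) v"
      if "OpE f t \<epsilon> D" and vars: "\<forall>\<^sub>S x. is_var x \<and> subterm x (OpE f t) \<longrightarrow> x \<epsilon> dom A"
    proof -
      note e = D(3)[OF that(1)]
      have arg: "\<exists>\<^sub>S v. has_value \<rho> \<SS> A (t \<bullet> k) v" if k: "k \<epsilon> n" for k
      proof -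
        have "immediate_sub (t \<bullet> k) (OpE f t)"
          using immediate_sub_OpE[OF set] t k unfolding is_seq_def by blast
        then have "subterm x (OpE f t)" if "subterm x (t \<bullet> k)" for x
          using that subexpression_immediate[OF isset_term[OF e]]
            subexpression_iff_subterm[OF e] subexpression_iff_subterm[OF args[OF k]] by blast
        with IH[OF k] D(4)[OF f t \<open>OpE f t \<epsilon> D\<close> k] vars show ?thesis by blast
      qed
      have "\<exists>w. is_seq n w \<and> (\<forall>k. k \<epsilon> n \<longrightarrow> has_value \<rho> \<SS> A (val t k) (w \<bullet> k))"
      proof (rule seq_exists)
        show "isset n" using isset_op_symbol(2)[OF f] .
        show "predicative (\<lambda>e. has_value \<rho> \<SS> A (val t (e 0)) (e (Suc 0)))"
          by (intro predicative_intros)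
        show "\<exists>\<^sub>S y. has_value \<rho> \<SS> A (val t k) y" if "k \<epsilon> n" for k
          using arg[OF that] seq_app(3)[OF t that] by simp
        show "y = z" if "k \<epsilon> n" "isset y" "isset z" "has_value \<rho> \<SS> A (val t k) y"
          "has_value \<rho> \<SS> A (val t k) z" for k y z
          using unique[OF D(4)[OF f t \<open>OpE f t \<epsilon> D\<close> that(1)] that(2,3)] that(4,5) seq_app(3)[OF t that(1)]
          by simp
      qed
      then obtain w where w: "is_seq n w" "\<And>k. k \<epsilon> n \<Longrightarrow> has_value \<rho> \<SS> A (t \<bullet> k) (w \<bullet> k)"
        using seq_app(3)[OF t] by metis
      have "tuple_in (universe \<rho> \<SS>) n w"
        unfolding tuple_in_def using w has_value_universe[OF A w(2)] seq_app(2)[OF t] seq_app(2)[OF w(1)] by blast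
      then have dom: "w \<epsilon> dom (interp \<SS> f)" using interp_op(2)[OF f] by blast
      define v where "v = interp \<SS> f \<bullet> w"
      have v: "isset v" "\<langle>f, \<langle>w, v\<rangle>\<rangle> \<epsilon> \<SS>"
        using app_pair[OF interp_op(1)[OF f] dom] by (simp_all add: v_def mem_interp)
      \<comment> \<open>The new pair for \<open>OpE f t\<close> has its argument pairs already in
        \<open>g\<close>, so the enlarged set is still a partial valuation.\<close>
      obtain h where h: "isset h" "\<And>p. p \<epsilon> h \<longleftrightarrow> p \<epsilon> g \<or> p = \<langle>OpE f t, v\<rangle>"
        using set_insert[OF g(1) isset_opair[OF isset_OpE[OF set] v(1)]] by blast
      have gh: "\<langle>t \<bullet> k, w \<bullet> k\<rangle> \<epsilon> g" if "k \<epsilon> n" for k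
        using mem_g w(2) D(4)[OF f t \<open>OpE f t \<epsilon> D\<close>] seq_app(2)[OF t] seq_app(2)[OF w(1)] that by blast
      have "partial_valuation \<rho> \<SS> A h"
      proof (rule partial_valuationI)
        fix d u assume d: "isset d" "isset u" "\<langle>d, u\<rangle> \<epsilon> h"
        then consider "\<langle>d, u\<rangle> \<epsilon> g" | "d = OpE f t" "u = v" using h(2) set v(1) by auto
        then show "(is_var d \<and> \<langle>d, u\<rangle> \<epsilon> A) \<or>
           (\<exists>f n t w. op_symbol \<rho> f n \<and> is_seq n t \<and> is_seq n w \<and> d = OpE f t \<and>
              \<langle>f, \<langle>w, u\<rangle>\<rangle> \<epsilon> \<SS> \<and> (\<forall>k. k \<epsilon> n \<longrightarrow> \<langle>t \<bullet> k, w \<bullet> k\<rangle> \<epsilon> h))"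
        proof cases
          case 1
          from g_cases[OF this d(1,2)] h(2) show ?thesis by blast
        next
          case 2
          with f t w(1) v(2) gh h(2) show ?thesis by blast
        qed
      qed
      then show ?thesis unfolding has_value_def using h v(1) by blast
    qed
    then show "OpE f t \<epsilon> D \<and> (\<forall>\<^sub>S x. is_var x \<and> subterm x (OpE f t) \<longrightarrow> x \<epsilon> dom A) \<longrightarrow>
        (\<exists>\<^sub>S v. has_value \<rho> \<SS> A (OpE f t) v)" by blast
  qed
  moreover have "x \<epsilon> dom A" if "is_var x" "subterm x e" for x
    using that free mem_Free[OF e] subexpression_iff_subterm[OF e] unfolding included_def by blast
  ultimately show ?thesis using e D(2) by blast
qed

lemma valuation_function_exists: "\<exists>F. is_valuation_function \<rho> \<SS> (Terms \<rho>) F"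
proof -
  \<comment> \<open>The signature and the structure may be proper classes; they enter as parameters,
    never as quantified variables.\<close>
  have "predicative (\<lambda>e. \<exists>\<^sub>S d A v. e 0 = \<langle>\<langle>d, A\<rangle>, v\<rangle> \<and> term_assignment \<rho> \<SS> d A \<and> has_value \<rho> \<SS> A d v)"
    by (intro predicative_intros)
  from collects[OF this] obtain F where F: "\<And>p. p \<epsilon> F \<longleftrightarrow> isset p \<and>
    (\<exists>\<^sub>S d A v. p = \<langle>\<langle>d, A\<rangle>, v\<rangle> \<and> term_assignment \<rho> \<SS> d A \<and> has_value \<rho> \<SS> A d v)"
    by blast
  have mem: "\<langle>q, v\<rangle> \<epsilon> F \<longleftrightarrow> (\<exists>e A. q = \<langle>e, A\<rangle> \<and> term_assignment \<rho> \<SS> e A \<and> has_value \<rho> \<SS> A e v)"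
    if "isset q" "isset v" for q v
    unfolding F using that term_assignment_isset by (metis opair_eq_iff isset_opair)
  have pair: "\<langle>\<langle>e, A\<rangle>, v\<rangle> \<epsilon> F \<longleftrightarrow> has_value \<rho> \<SS> A e v"
    if "term_assignment \<rho> \<SS> e A" "isset v" for e A v
    using mem[of "\<langle>e, A\<rangle>" v] that term_assignment_isset by (metis opair_eq_iff isset_opair)
  have unique: "u = v" if "term_assignment \<rho> \<SS> e A" "isset u" "isset v"
    "has_value \<rho> \<SS> A e u" "has_value \<rho> \<SS> A e v" for e A u v
    using that has_value_unique unfolding term_assignment_def is_assignment_def by blast
  have exist: "\<exists>\<^sub>S v. has_value \<rho> \<SS> A e v" if "term_assignment \<rho> \<SS> e A" for e A
    using that has_value_exists unfolding term_assignment_def is_assignment_def by blast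
  have func: "is_function F"
  proof (rule is_functionI)
    show "\<exists>\<^sub>S x y. p = \<langle>x, y\<rangle>" if "p \<epsilon> F" for p using that F isset_opair by metis
    show "y = z" if "isset x" "isset y" "isset z" "\<langle>x, y\<rangle> \<epsilon> F" "\<langle>x, z\<rangle> \<epsilon> F" for x y z
      using that mem pair unique by metis
  qed
  have dom: "p \<epsilon> dom F \<longleftrightarrow> (\<exists>e A. p = \<langle>e, A\<rangle> \<and> term_assignment \<rho> \<SS> e A)" for p
    unfolding mem_dom using mem exist term_assignment_isset isset_opair by metis
  have vals: "has_value \<rho> \<SS> A e (F \<bullet> \<langle>e, A\<rangle>)" "isset (F \<bullet> \<langle>e, A\<rangle>)"
    if "term_assignment \<rho> \<SS> e A" for e A
    using app_pair[OF func, of "\<langle>e, A\<rangle>"] dom pair that by blast+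
  have eq: "F \<bullet> \<langle>e, A\<rangle> = v" if "term_assignment \<rho> \<SS> e A" "isset v" "has_value \<rho> \<SS> A e v" for e A v
    using unique vals that by blast
  have "F \<bullet> \<langle>e, A\<rangle> \<epsilon> universe \<rho> \<SS> \<and> tarski_clauses \<rho> \<SS> F e A" if eA: "term_assignment \<rho> \<SS> e A" for e A
  proof
    have e: "is_term \<rho> e" "isset e" and A: "is_function A" "\<forall>x. x \<epsilon> dom A \<longrightarrow> A \<bullet> x \<epsilon> universe \<rho> \<SS>" "Free e \<sqsubseteq> dom A"
      using eA term_assignment_isset unfolding term_assignment_def is_assignment_def by blast+
    show "F \<bullet> \<langle>e, A\<rangle> \<epsilon> universe \<rho> \<SS>" using has_value_universe[OF A(1,2)] vals[OF eA] e(2) by blast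
    from vals(1)[OF eA] e(2) vals(2)[OF eA] show "tarski_clauses \<rho> \<SS> F e A"
    proof (cases rule: has_value_cases)
      case var
      then show ?thesis using tarski_clauses_var app_eq[OF A(1)] e(2) vals(2)[OF eA] by simp
    next
      case (op f n t w)
      note set = isset_op_symbol(1)[OF op(1)] isset_seq[OF op(2)]
      have n: "dom t = n" using op(2) unfolding is_seq_def by blast
      \<comment> \<open>By uniqueness of the argument values, the \<open>w\<close> from the witness
        is the value sequence that the Tarski clause asks for.\<close>
      have "F \<bullet> \<langle>t \<bullet> k, A\<rangle> = w \<bullet> k" if k: "k \<epsilon> n" for k
      proof (rule eq)
        show "term_assignment \<rho> \<SS> (t \<bullet> k) A" using term_assignment_arg[OF _ set] eA op(4) k n by simp
      qed (use seq_app(2)[OF op(3) k] op(6)[OF k] in auto)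
      then have "values_of F A t w" unfolding values_of_def using n op(3) by simp
      moreover have "F \<bullet> \<langle>OpE f t, A\<rangle> = interp \<SS> f \<bullet> w"
        using interp_app_eq(1)[OF op(1)] op(4,5) isset_seq[OF op(3)] vals(2)[OF eA] by simp
      ultimately show ?thesis using tarski_clauses_OpE[OF set] op(4) by blast
    qed
  qed
  then have "is_valuation_function \<rho> \<SS> (Terms \<rho>) F"
    unfolding valuation_function_iff using func dom by blast
  then show ?thesis by blast
qed

end

theorem theorem2p4:
  fixes mem :: "'c \<Rightarrow> 'c \<Rightarrow> bool" and \<rho> \<SS> :: 'c
  assumes "class_theory_C mem"
    and "class_language.is_signature mem \<rho>"
    and "class_language.is_structure mem \<rho> \<SS>"
  shows "\<exists>!F. class_language.is_valuation_function mem \<rho> \<SS> (class_language.Terms mem \<rho>) F"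
proof -
  interpret class_theory_C mem by fact
  interpret class_structure mem \<rho> \<SS> by unfold_locales fact
  show ?thesis using valuation_function_exists valuation_function_unique by blast
qed

end
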